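(* Let $A\in\mathbb{R}^{m\times n}$ with $m>n$ be nonzero, and let $b\in\mathbb{R}^m$ be such that the linear system $Ax=b$ is inconsistent. Let $\{\mathcal{I}_i\}_{i=1}^s$ and $\{\mathcal{J}_j\}_{j=1}^t$ be partitions of $\{1,\dots,m\}$ and $\{1,\dots,n\}$, respectively, and let $x^{(k)}$, $k=0,1,2,\dots$, be the random vectors generated by the extended randomized multiple row (ERMR) method for $Ax=b$ (defined in the context) with initial vectors $x^{(0)}\in\mathcal{R}(A^T)$ and $y^{(0)}\in b+\mathcal{R}(A)$. Define $$\rho_1=1-\frac{1}{\beta_{\max}^{I}}\frac{\sigma_{\min}^2(A)}{\|A\|_F^2},\qquad \rho_2=1-\frac{1}{\beta_{\max}^{J}}\frac{\sigma_{\min}^2(A)}{\|A\|_F^2},$$ and suppose $\rho_1\ne\rho_2$. Then, for every $k\ge 0$, $$\mathbb{E}\left[\|x^{(k)}-x^\ast\|^2\right]\le \omega\,\rho^{k},$$ where $x^\ast=A^\dagger b$, $\rho=\max\{\rho_1,\rho_2\}$, and $$\omega=\|x^{(0)}-x^\ast\|^2+\frac{s}{|\rho_1-\rho_2|}\,\frac{\|y^{(0)}-b_N\|^2}{\|A\|_F^2\,\beta_{\min}^{I}},$$ with $b_N=(I_m-AA^\dagger)b$.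
   Context: Notation: $\|\cdot\|$ is the Euclidean norm of a vector, $\|\cdot\|_F$ the Frobenius norm, $A^\dagger$ the Moore-Penrose pseudoinverse, $\mathcal{R}(\cdot)$ the range (column space), $I_m$ the identity matrix of size $m$. $\sigma_{\min}(\cdot)$ and $\sigma_{\max}(\cdot)$ denote the smallest nonzero and the largest singular value. $A_{l,:}$ and $A_{:,l}$ are the $l$-th row and $l$-th column of $A$; $A_{\mathcal{I},:}$ (resp. $A_{:,\mathcal{J}}$) is the submatrix of rows indexed by $\mathcal{I}$ (resp. columns indexed by $\mathcal{J}$). $\mu_l$ and $\nu_l$ are the $l$-th standard unit vectors of $\mathbb{R}^m$ and $\mathbb{R}^n$. A partition of a finite set is a family of pairwise disjoint sets whose union is that set; all blocks $A_{\mathcal{I}_i,:}$ and $A_{:,\mathcal{J}_j}$ are assumed nonzero, so that the following constants are defined: $$\beta_{\max}^{I}=\max_{1\le i\le s}\frac{\sigma_{\max}^2(A_{\mathcal{I}_i,:})}{\|A_{\mathcal{I}_i,:}\|_F^2},\quad \beta_{\min}^{I}=\min_{1\le i\le s}\frac{\sigma_{\min}^2(A_{\mathcal{I}_i,:})}{\|A_{\mathcal{I}_i,:}\|_F^2},\quad \beta_{\max}^{J}=\max_{1\le j\le t}\frac{\sigma_{\max}^2(A_{:,\mathcal{J}_j})}{\|A_{:,\mathcal{J}_j}\|_F^2}.$$ ERMR method for $Ax=b$: given deterministic $x^{(0)}\in\mathbb{R}^n$ and $y^{(0)}\in\mathbb{R}^m$, for $k=0,1,2,\dots$: (1) pick $j\in\{1,\dots,t\}$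 with probability $q_j=\|A_{:,\mathcal{J}_j}\|_F^2/\|A\|_F^2$, set $\zeta_k=\sum_{l\in\mathcal{J}_j}(-A_{:,l}^Ty^{(k)})\nu_l\in\mathbb{R}^n$ and $$y^{(k+1)}=y^{(k)}-\frac{\zeta_k^TA^Ty^{(k)}}{\|A\zeta_k\|^2}A\zeta_k;$$ (2) pick $i\in\{1,\dots,s\}$ with probability $p_i=\|A_{\mathcal{I}_i,:}\|_F^2/\|A\|_F^2$, set $\eta_k=\sum_{l\in\mathcal{I}_i}(b_l-y^{(k+1)}_l-A_{l,:}x^{(k)})\mu_l\in\mathbb{R}^m$ and $$x^{(k+1)}=x^{(k)}+\frac{\eta_k^T(b-y^{(k+1)}-Ax^{(k)})}{\|A^T\eta_k\|^2}A^T\eta_k.$$ All index choices are mutually independent. If $A\zeta_k=0$ (resp. $A^T\eta_k=0$), the corresponding correction term is taken to be $0$, i.e. $y^{(k+1)}=y^{(k)}$ (resp. $x^{(k+1)}=x^{(k)}$). $\mathbb{E}$ is the expectation over the random index choices. *)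

theory Defs
  imports "HOL-Analysis.Analysis" "HOL-Probability.Probability"
begin

text \<open>
  Submatrices.  The blocks of a matrix have sizes that vary with the block, so the submatrix of
  \<open>A\<close> with rows in \<open>R\<close> and columns in \<open>C\<close> is represented by the triple \<open>A\<close>, \<open>R\<close>, \<open>C\<close>; only
  entries \<open>A $ r $ c\<close> with \<open>r \<in> R\<close>, \<open>c \<in> C\<close> are used.  The matrix \<open>A\<close> itself is the case
  \<open>R = UNIV\<close>, \<open>C = UNIV\<close>.
\<close>

definition frob_norm :: "real^'n^'m \<Rightarrow> 'm set \<Rightarrow> 'n set \<Rightarrow> real" where
  "frob_norm A R C = sqrt (\<Sum>r\<in>R. \<Sum>c\<in>C. (A $ r $ c)\<^sup>2)"

text \<open>Entry \<open>(c, d)\<close> of \<open>B\<^sup>T B\<close>, where \<open>B\<close> is the submatrix of \<open>A\<close> with rows \<open>R\<close>; restricting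
  \<open>c\<close> and \<open>d\<close> to \<open>C\<close> gives the Gram matrix of the submatrix with rows \<open>R\<close> and columns \<open>C\<close>.\<close>

definition gram_entry :: "real^'n^'m \<Rightarrow> 'm set \<Rightarrow> 'n \<Rightarrow> 'n \<Rightarrow> real" where
  "gram_entry A R c d = (\<Sum>r\<in>R. A $ r $ c * A $ r $ d)"

text \<open>Nonnegative square roots of the eigenvalues of \<open>B\<^sup>T B\<close>.  A submatrix with fewer rows than
  columns thereby acquires the additional value \<open>0\<close>, which affects neither the largest nor the
  smallest nonzero singular value of a nonzero submatrix.  Only the coordinates in \<open>C\<close> of the
  eigenvector \<open>v\<close> are relevant.\<close>

definition singular_values :: "real^'n^'m \<Rightarrow> 'm set \<Rightarrow> 'n set \<Rightarrow> real set" where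
  "singular_values A R C =
     {\<sigma>. \<sigma> \<ge> 0 \<and> (\<exists>v::real^'n. (\<exists>c\<in>C. v $ c \<noteq> 0) \<and>
            (\<forall>c\<in>C. (\<Sum>d\<in>C. gram_entry A R c d * v $ d) = \<sigma>\<^sup>2 * v $ c))}"

definition sigma_max :: "real^'n^'m \<Rightarrow> 'm set \<Rightarrow> 'n set \<Rightarrow> real" where
  "sigma_max A R C = Max (singular_values A R C)"

definition sigma_min :: "real^'n^'m \<Rightarrow> 'm set \<Rightarrow> 'n set \<Rightarrow> real" where
  "sigma_min A R C = Min (singular_values A R C - {0})"

definition beta_max_rows :: "real^'n^'m \<Rightarrow> nat \<Rightarrow> (nat \<Rightarrow> 'm set) \<Rightarrow> real" where
  "beta_max_rows A s I =
     Max ((\<lambda>i. (sigma_max A (I i) UNIV)\<^sup>2 / (frob_norm A (I i) UNIV)\<^sup>2) ` {1..s})"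

definition beta_min_rows :: "real^'n^'m \<Rightarrow> nat \<Rightarrow> (nat \<Rightarrow> 'm set) \<Rightarrow> real" where
  "beta_min_rows A s I =
     Min ((\<lambda>i. (sigma_min A (I i) UNIV)\<^sup>2 / (frob_norm A (I i) UNIV)\<^sup>2) ` {1..s})"

definition beta_max_cols :: "real^'n^'m \<Rightarrow> nat \<Rightarrow> (nat \<Rightarrow> 'n set) \<Rightarrow> real" where
  "beta_max_cols A t J =
     Max ((\<lambda>j. (sigma_max A UNIV (J j))\<^sup>2 / (frob_norm A UNIV (J j))\<^sup>2) ` {1..t})"

definition is_pinv :: "real^'n^'m \<Rightarrow> real^'m^'n \<Rightarrow> bool" where
  "is_pinv A X \<longleftrightarrow> A ** X ** A = A \<and> X ** A ** X = X \<and>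
     transpose (A ** X) = A ** X \<and> transpose (X ** A) = X ** A"

definition pinv :: "real^'n^'m \<Rightarrow> real^'m^'n" where
  "pinv A = (THE X. is_pinv A X)"

text \<open>In the two updates a vanishing denominator means that the vector being scaled is zero, so
  the correction term is zero, as the method prescribes in this case.\<close>

definition y_step :: "real^'n^'m \<Rightarrow> 'n set \<Rightarrow> real^'m \<Rightarrow> real^'m" where
  "y_step A Jj y =
     (let \<zeta> = (\<Sum>l\<in>Jj. (- (column l A \<bullet> y)) *\<^sub>R (axis l 1 :: real^'n))
      in y - ((\<zeta> \<bullet> (transpose A *v y)) / (norm (A *v \<zeta>))\<^sup>2) *\<^sub>R (A *v \<zeta>))"

definition x_step :: "real^'n^'m \<Rightarrow> real^'m \<Rightarrow> 'm set \<Rightarrow> real^'m \<Rightarrow> real^'n \<Rightarrow> real^'n" where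
  "x_step A b Ii y x =
     (let \<eta> = (\<Sum>l\<in>Ii. (b $ l - y $ l - row l A \<bullet> x) *\<^sub>R (axis l 1 :: real^'m))
      in x + ((\<eta> \<bullet> (b - y - A *v x)) / (norm (transpose A *v \<eta>))\<^sup>2) *\<^sub>R (transpose A *v \<eta>))"

text \<open>The pair \<open>(x\<^sup>(\<^sup>k\<^sup>), y\<^sup>(\<^sup>k\<^sup>))\<close> produced by given sequences \<open>ri\<close> of row block choices and \<open>cj\<close> of
  column block choices; step \<open>k\<close> uses \<open>cj k\<close> for \<open>y\<close> and then \<open>ri k\<close> for \<open>x\<close>.\<close>

primrec ermr ::
  "real^'n^'m \<Rightarrow> real^'m \<Rightarrow> (nat \<Rightarrow> 'm set) \<Rightarrow> (nat \<Rightarrow> 'n set) \<Rightarrow> real^'n \<Rightarrow> real^'m \<Rightarrow>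
   (nat \<Rightarrow> nat) \<Rightarrow> (nat \<Rightarrow> nat) \<Rightarrow> nat \<Rightarrow> (real^'n) \<times> (real^'m)" where
  "ermr A b I J x0 y0 ri cj 0 = (x0, y0)"
| "ermr A b I J x0 y0 ri cj (Suc k) =
     (let x = fst (ermr A b I J x0 y0 ri cj k);
          y = snd (ermr A b I J x0 y0 ri cj k);
          y' = y_step A (J (cj k)) y;
          x' = x_step A b (I (ri k)) y' x
      in (x', y'))"

end

theory Submission
  imports Defs
begin

text \<open>
  With \<open>e = y - b_N\<close> and \<open>g = (A\<^sup>T e)\<close> restricted to the
  column block, the update of \<open>y\<close> removes \<open>\<parallel>g\<parallel>\<^sup>4 / \<parallel>A g\<parallel>\<^sup>2 \<ge> \<parallel>g\<parallel>\<^sup>2 / \<sigma>\<^sub>m\<^sub>a\<^sub>x\<^sup>2\<close> from \<open>\<parallel>e\<parallel>\<^sup>2\<close>.  With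
  \<open>u = x - x_star\<close>, a row block \<open>B\<close> of \<open>A\<close>, and \<open>r = - B u - e\<close> restricted to that block, completing
  the square shows that the update of \<open>x\<close> changes \<open>\<parallel>u\<parallel>\<^sup>2\<close> by \<open>\<alpha> (\<parallel>e\<parallel>\<^sup>2 - \<parallel>B u\<parallel>\<^sup>2)\<close>, where
  \<open>\<alpha> = \<parallel>r\<parallel>\<^sup>2 / \<parallel>B\<^sup>T r\<parallel>\<^sup>2\<close> and only the block part of \<open>e\<close> counts.  Since \<open>e\<close> stays in the range of
  \<open>A\<close>, \<open>r\<close> lies in the range of \<open>B\<close>, hence \<open>\<alpha>\<close> is between \<open>1 / \<sigma>\<^sub>m\<^sub>a\<^sub>x\<^sup>2\<close> and \<open>1 / \<sigma>\<^sub>m\<^sub>i\<^sub>n\<^sup>2\<close> of the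
  block.  Averaging over the blocks gives \<open>E\<parallel>e'\<parallel>\<^sup>2 \<le> \<rho>2 \<parallel>e\<parallel>\<^sup>2\<close> and
  \<open>E\<parallel>u'\<parallel>\<^sup>2 \<le> \<rho>1 \<parallel>u\<parallel>\<^sup>2 + C \<parallel>e'\<parallel>\<^sup>2\<close>, and solving this recurrence gives the bound.
\<close>

section \<open>Singular values of submatrices\<close>

text \<open>Keeps products in the form \<open>transpose B *v r\<close>, so that facts about
  \<open>*v\<close> also apply to the transpose.\<close>

declare transpose_matrix_vector [simp del]

text \<open>A minimiser of the Rayleigh quotient over an invariant subspace is an eigenvector.  This
  replaces the spectral theorem for the extremal singular values.\<close>

lemma extremal_eigenvector:
  fixes f :: "'a::euclidean_space \<Rightarrow> 'a"
  assumes "linear f" and sym: "\<And>x y. f x \<bullet> y = x \<bullet> f y"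
    and W: "subspace W" "f ` W \<subseteq> W" "W \<noteq> {0}"
  obtains l v where "v \<in> W" "v \<noteq> 0" "f v = l *\<^sub>R v"
    "\<And>w. w \<in> W \<Longrightarrow> l * (norm w)\<^sup>2 \<le> f w \<bullet> w"
proof -
  interpret linear f by fact
  have sphere: "(1 / norm w) *\<^sub>R w \<in> sphere 0 1 \<inter> W" if "w \<in> W" "w \<noteq> 0" for w
    using that W(1) by (simp add: subspace_scale)
  have "compact (sphere 0 1 \<inter> W)"
    using W(1) by (simp add: closed_subspace compact_Int_closed)
  moreover have "sphere 0 1 \<inter> W \<noteq> {}"
    using sphere subspace_0[OF W(1)] W(3) by blast
  moreover have "continuous_on (sphere 0 1 \<inter> W) (\<lambda>w. f w \<bullet> w)"
    by (intro continuous_intros linear_continuous_on) (simp add: assms(1) linear_conv_bounded_linear[symmetric])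
  ultimately obtain v where "v \<in> sphere 0 1 \<inter> W" "\<forall>w\<in>sphere 0 1 \<inter> W. f v \<bullet> v \<le> f w \<bullet> w"
    using continuous_attains_inf[of "sphere 0 1 \<inter> W" "\<lambda>w. f w \<bullet> w"] by blast
  then have v: "v \<in> W" "norm v = 1"
    and least: "\<And>w. w \<in> W \<Longrightarrow> norm w = 1 \<Longrightarrow> f v \<bullet> v \<le> f w \<bullet> w"
    by auto
  define l where "l = f v \<bullet> v"
  have lower: "l * (norm w)\<^sup>2 \<le> f w \<bullet> w" if "w \<in> W" for w
  proof (cases "w = 0")
    case False
    have "l \<le> f ((1 / norm w) *\<^sub>R w) \<bullet> ((1 / norm w) *\<^sub>R w)"
      unfolding l_def using sphere[OF that False] by (intro least) auto
    also have "\<dots> = (f w \<bullet> w) / (norm w)\<^sup>2"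
      by (simp add: scale power2_eq_square)
    finally show ?thesis
      using False by (simp add: field_simps)
  qed (simp add: zero)
  \<comment> \<open>The residual of the eigenvalue equation. Moving the minimiser by
    \<open>t *\<^sub>R d\<close> changes the form by a quadratic in \<open>t\<close> with linear
    coefficient \<open>2 * (d \<bullet> d)\<close>. It must stay nonnegative, which forces
    \<open>d = 0\<close>.\<close>
  define d where "d = f v - l *\<^sub>R v"
  define Q where "Q = f d \<bullet> d - l * (norm d)\<^sup>2"
  have d: "d \<in> W"
    unfolding d_def using W v(1) by (intro subspace_diff subspace_scale) auto
  have Q: "Q \<ge> 0"
    unfolding Q_def using lower[OF d] by simp
  have quad: "0 \<le> 2 * t * (d \<bullet> d) + t\<^sup>2 * Q" for t
  proof -
    have "v + t *\<^sub>R d \<in> W"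
      using W v(1) d by (intro subspace_add subspace_scale)
    then have "0 \<le> f (v + t *\<^sub>R d) \<bullet> (v + t *\<^sub>R d) - l * ((v + t *\<^sub>R d) \<bullet> (v + t *\<^sub>R d))"
      using lower by (simp add: power2_norm_eq_inner)
    also have "\<dots> = (f v \<bullet> v - l * (v \<bullet> v)) + 2 * t * (d \<bullet> (f v) - l * (d \<bullet> v)) + t\<^sup>2 * Q"
    proof -
      have "f d \<bullet> v = f v \<bullet> d" "d \<bullet> f v = f v \<bullet> d" "d \<bullet> v = v \<bullet> d"
        using sym[of d v] by (simp_all add: inner_commute)
      then show ?thesis
        unfolding Q_def power2_norm_eq_inner
        by (simp add: add scale inner_add_left inner_add_right power2_eq_square algebra_simps)
    qed
    also have "\<dots> = 2 * t * (d \<bullet> d) + t\<^sup>2 * Q"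
    proof -
      have "v \<bullet> v = 1" using v(2) by (simp add: norm_eq_1)
      moreover have "d \<bullet> (f v) - l * (d \<bullet> v) = d \<bullet> d"
        by (simp add: d_def inner_diff_right)
      ultimately show ?thesis by (simp add: l_def)
    qed
    finally show ?thesis .
  qed
  have "d = 0"
  proof (rule ccontr)
    assume "d \<noteq> 0"
    then have "d \<bullet> d > 0" by simp
    \<comment> \<open>This is \<open>quad\<close> at \<open>t = - (d \<bullet> d) / (Q + 1)\<close>,
      with denominators cleared. Using \<open>Q + 1\<close> instead of \<open>Q\<close> covers the
      case \<open>Q = 0\<close>.\<close>
    have "0 \<le> (2 * (- (d \<bullet> d) / (Q + 1)) * (d \<bullet> d) + (- (d \<bullet> d) / (Q + 1))\<^sup>2 * Q) * (Q + 1)\<^sup>2"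
      by (intro mult_nonneg_nonneg quad) simp
    also have "\<dots> = - ((d \<bullet> d)\<^sup>2 * (Q + 2))"
      using Q by (simp add: field_simps power2_eq_square add_nonneg_eq_0_iff)
    also have "\<dots> < 0"
      using \<open>d \<bullet> d > 0\<close> Q by simp
    finally show False by simp
  qed
  moreover have "v \<noteq> 0" using v(2) by auto
  ultimately show ?thesis
    using that[of v l] v(1) lower by (simp add: d_def)
qed

section \<open>Coordinate restriction and zero-padded submatrices\<close>

definition vec_restrict :: "'n set \<Rightarrow> real^'n \<Rightarrow> real^'n" where
  "vec_restrict S v = (\<chi> i. if i \<in> S then v $ i else 0)"

text \<open>The submatrix with rows \<open>R\<close> and columns \<open>C\<close>, padded with zeros to full size.\<close>

definition submatrix :: "real^'n^'m \<Rightarrow> 'm set \<Rightarrow> 'n set \<Rightarrow> real^'n^'m" where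
  "submatrix A R C = (\<chi> r c. if r \<in> R \<and> c \<in> C then A $ r $ c else 0)"

lemma vec_restrict_nth [simp]: "vec_restrict S v $ i = (if i \<in> S then v $ i else 0)"
  by (simp add: vec_restrict_def)

lemma vec_restrict_idem [simp]: "vec_restrict S (vec_restrict S v) = vec_restrict S v"
  by (simp add: vec_eq_iff)

lemma vec_restrict_UNIV [simp]: "vec_restrict UNIV v = v"
  by (simp add: vec_eq_iff)

lemma vec_restrict_minus: "vec_restrict S (- v) = - vec_restrict S v"
  by (simp add: vec_eq_iff)

lemma vec_restrict_eq_sum: "vec_restrict S v = (\<Sum>l\<in>S. (v $ l) *\<^sub>R (axis l 1 :: real^'n))"
  by (simp add: vec_eq_iff axis_def if_distrib[of "\<lambda>x. _ * x"] cong: if_cong)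

lemma inner_vec_restrict: "vec_restrict S v \<bullet> w = vec_restrict S v \<bullet> vec_restrict S w"
  by (simp add: inner_vec_def if_distrib[of "\<lambda>x. x * _"] cong: if_cong)

lemma norm_vec_restrict: "(norm (vec_restrict S v))\<^sup>2 = (\<Sum>l\<in>S. (v $ l)\<^sup>2)"
  by (simp add: power2_norm_eq_inner inner_vec_def if_distrib[of "\<lambda>x. x * _"] sum.If_cases
      power2_eq_square[of "_ $ _"] cong: if_cong)

text \<open>Pythagoras for the orthogonal pieces cut out by a partition. It recombines the block
  terms into a full norm when averaging over blocks.\<close>

lemma sum_norm_vec_restrict:
  assumes "disjoint_family_on S N" "(\<Union>i\<in>N. S i) = UNIV" "finite N"
  shows "(\<Sum>i\<in>N. (norm (vec_restrict (S i) v))\<^sup>2) = (norm v)\<^sup>2"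
proof -
  have "(\<Sum>i\<in>N. \<Sum>l\<in>S i. (v $ l)\<^sup>2) = (\<Sum>l\<in>(\<Union>i\<in>N. S i). (v $ l)\<^sup>2)"
    using assms by (intro sum.UNION_disjoint[symmetric]) (auto simp: disjoint_family_on_def)
  then show ?thesis
    using assms norm_vec_restrict[of UNIV v] by (simp add: norm_vec_restrict)
qed

lemma submatrix_UNIV [simp]: "submatrix A UNIV UNIV = A"
  by (simp add: submatrix_def vec_eq_iff)

lemma submatrix_mult: "submatrix A R C *v v = vec_restrict R (A *v vec_restrict C v)"
  by (simp add: submatrix_def vec_eq_iff matrix_vector_mult_def if_distrib if_distribR cong: if_cong)

lemma transpose_submatrix: "transpose (submatrix A R C) = submatrix (transpose A) C R"
  by (auto simp: submatrix_def transpose_def vec_eq_iff)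

lemma transpose_submatrix_mult: "transpose (submatrix A R C) *v v = vec_restrict C (transpose A *v vec_restrict R v)"
  by (simp add: transpose_submatrix submatrix_mult)

lemma frob_norm_sq: "(frob_norm A R C)\<^sup>2 = (\<Sum>r\<in>R. \<Sum>c\<in>C. (A $ r $ c)\<^sup>2)"
  by (simp add: frob_norm_def sum_nonneg)

lemma frob_norm_pos:
  assumes "submatrix A R C \<noteq> 0"
  shows "(frob_norm A R C)\<^sup>2 > 0"
proof -
  obtain r c where rc: "r \<in> R" "c \<in> C" "A $ r $ c \<noteq> 0"
    using assms by (auto simp: submatrix_def vec_eq_iff split: if_splits)
  have "0 < (A $ r $ c)\<^sup>2" using rc by simp
  also have "\<dots> \<le> (\<Sum>c\<in>C. (A $ r $ c)\<^sup>2)"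
    using rc by (intro member_le_sum) auto
  also have "\<dots> \<le> (frob_norm A R C)\<^sup>2"
    unfolding frob_norm_sq using rc by (intro member_le_sum[of r R "\<lambda>r. \<Sum>c\<in>C. (A $ r $ c)\<^sup>2"]) (auto intro: sum_nonneg)
  finally show ?thesis .
qed

section \<open>Singular values through the Gram operator\<close>

lemma gram_inner: "(transpose B *v (B *v v)) \<bullet> w = (B *v v) \<bullet> (B *v w)"
  for B :: "real^'n^'m"
  by (metis dot_lmul_matrix inner_commute transpose_matrix_vector)

lemma transpose_inner: "(transpose B *v r) \<bullet> w = r \<bullet> (B *v w)"
  for B :: "real^'n^'m"
  by (metis dot_lmul_matrix transpose_matrix_vector)

lemma sum_gram_entry:
  assumes "c \<in> C"
  shows "(\<Sum>d\<in>C. gram_entry A R c d * v $ d) =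
    (transpose (submatrix A R C) *v (submatrix A R C *v v)) $ c"
proof -
  let ?B = "submatrix A R C"
  have "(\<Sum>d\<in>C. gram_entry A R c d * v $ d) = (\<Sum>d\<in>C. \<Sum>r\<in>R. A $ r $ c * A $ r $ d * v $ d)"
    by (simp add: gram_entry_def sum_distrib_right)
  also have "\<dots> = (\<Sum>r\<in>R. A $ r $ c * (\<Sum>d\<in>C. A $ r $ d * v $ d))"
    by (subst sum.swap) (simp add: sum_distrib_left mult.assoc)
  also have "\<dots> = (transpose ?B *v (?B *v v)) $ c"
    using assms
    unfolding transpose_submatrix_mult submatrix_mult using assms
    by (simp add: matrix_vector_mult_def transpose_def
        if_distrib[of "\<lambda>x. _ * x"] sum.If_cases cong: if_cong)
  finally show ?thesis .
qed

text \<open>Passes from entries to eigenvectors of the Gram operator of the padded block. A witness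
  may be restricted to \<open>C\<close>, because the block ignores all other coordinates.\<close>

lemma singular_values_iff:
  "\<sigma> \<in> singular_values A R C \<longleftrightarrow> \<sigma> \<ge> 0 \<and>
    (\<exists>v. v \<noteq> 0 \<and> vec_restrict C v = v \<and>
      transpose (submatrix A R C) *v (submatrix A R C *v v) = \<sigma>\<^sup>2 *\<^sub>R v)"
  (is "_ \<longleftrightarrow> _ \<and> (\<exists>v. ?E v)")
proof -
  let ?B = "submatrix A R C"
  have fwd: "?E (vec_restrict C v)"
    if "\<exists>c\<in>C. v $ c \<noteq> 0" "\<forall>c\<in>C. (\<Sum>d\<in>C. gram_entry A R c d * v $ d) = \<sigma>\<^sup>2 * v $ c" for v
  proof -
    have "transpose ?B *v (?B *v vec_restrict C v) = \<sigma>\<^sup>2 *\<^sub>R vec_restrict C v"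
    proof (subst vec_eq_iff, rule allI)
      fix c
      have "?B *v vec_restrict C v = ?B *v v" by (simp add: submatrix_mult)
      then show "(transpose ?B *v (?B *v vec_restrict C v)) $ c = (\<sigma>\<^sup>2 *\<^sub>R vec_restrict C v) $ c"
        using that(2) sum_gram_entry[of c C A R v]
        by (cases "c \<in> C") (auto simp: transpose_submatrix_mult)
    qed
    then show ?thesis using that(1) by (auto simp: vec_eq_iff)
  qed
  have bwd: "(\<exists>c\<in>C. v $ c \<noteq> 0) \<and>
      (\<forall>c\<in>C. (\<Sum>d\<in>C. gram_entry A R c d * v $ d) = \<sigma>\<^sup>2 * v $ c)" if "?E v" for v
  proof -
    have "\<exists>c\<in>C. vec_restrict C v $ c \<noteq> 0"
      using that by (metis (mono_tags, lifting) vec_eq_iff vec_restrict_nth zero_index)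
    then show ?thesis using that by (auto simp: sum_gram_entry)
  qed
  have "(\<exists>v. (\<exists>c\<in>C. v $ c \<noteq> 0) \<and>
      (\<forall>c\<in>C. (\<Sum>d\<in>C. gram_entry A R c d * v $ d) = \<sigma>\<^sup>2 * v $ c)) \<longleftrightarrow> (\<exists>v. ?E v)"
  proof (intro iffI; elim exE conjE)
    fix v
    assume "\<exists>c\<in>C. v $ c \<noteq> 0" "\<forall>c\<in>C. (\<Sum>d\<in>C. gram_entry A R c d * v $ d) = \<sigma>\<^sup>2 * v $ c"
    from fwd[OF this] show "\<exists>v. ?E v" by (rule exI)
  next
    fix v
    assume "v \<noteq> 0" "vec_restrict C v = v" "transpose ?B *v (?B *v v) = \<sigma>\<^sup>2 *\<^sub>R v"
    then show "\<exists>v. (\<exists>c\<in>C. v $ c \<noteq> 0) \<and>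
      (\<forall>c\<in>C. (\<Sum>d\<in>C. gram_entry A R c d * v $ d) = \<sigma>\<^sup>2 * v $ c)"
      by (intro exI[of _ v] bwd conjI)
  qed
  then show ?thesis
    unfolding singular_values_def mem_Collect_eq by (rule arg_cong)
qed

text \<open>Eigenvectors of a symmetric operator for distinct eigenvalues are orthogonal, and a
  pairwise orthogonal set is finite. Finiteness gives \<open>Max\<close> and \<open>Min\<close> in
  \<open>sigma_max\<close> and \<open>sigma_min\<close> their meaning.\<close>

lemma finite_singular_values: "finite (singular_values A R C)"
proof -
  let ?G = "\<lambda>v. transpose (submatrix A R C) *v (submatrix A R C *v v)"
  let ?S = "singular_values A R C"
  obtain e where e: "\<And>\<sigma>. \<sigma> \<in> ?S \<Longrightarrow> e \<sigma> \<noteq> 0 \<and> ?G (e \<sigma>) = \<sigma>\<^sup>2 *\<^sub>R e \<sigma>"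
  proof -
    have "\<exists>v. \<sigma> \<in> ?S \<longrightarrow> v \<noteq> 0 \<and> ?G v = \<sigma>\<^sup>2 *\<^sub>R v" for \<sigma>
      unfolding singular_values_iff by auto
    then show ?thesis using that by metis
  qed
  have orth: "e \<sigma> \<bullet> e \<tau> = 0" if "\<sigma> \<in> ?S" "\<tau> \<in> ?S" "\<sigma> \<noteq> \<tau>" for \<sigma> \<tau>
  proof -
    have "\<sigma>\<^sup>2 * (e \<sigma> \<bullet> e \<tau>) = ?G (e \<sigma>) \<bullet> e \<tau>" using e that by simp
    also have "\<dots> = e \<sigma> \<bullet> ?G (e \<tau>)"
      by (simp add: gram_inner inner_commute[of "e \<sigma>"] inner_commute[of "submatrix A R C *v e \<sigma>"])
    also have "\<dots> = \<tau>\<^sup>2 * (e \<sigma> \<bullet> e \<tau>)" using e that by simp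
    finally have "(\<sigma>\<^sup>2 - \<tau>\<^sup>2) * (e \<sigma> \<bullet> e \<tau>) = 0" by (simp add: algebra_simps)
    moreover have "\<sigma>\<^sup>2 \<noteq> \<tau>\<^sup>2"
      using that by (simp add: singular_values_iff)
    ultimately show ?thesis by simp
  qed
  have "inj_on e ?S"
  proof (intro inj_onI, rule ccontr)
    fix \<sigma> \<tau> assume "\<sigma> \<in> ?S" "\<tau> \<in> ?S" "e \<sigma> = e \<tau>" "\<sigma> \<noteq> \<tau>"
    then show False using orth[of \<sigma> \<tau>] e[of \<sigma>] by simp
  qed
  moreover have "finite (e ` ?S)"
  proof (intro pairwise_orthogonal_imp_finite pairwiseI)
    fix v w assume "v \<in> e ` ?S" "w \<in> e ` ?S" "v \<noteq> w"
    then show "orthogonal v w" using orth by (auto simp: orthogonal_def)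
  qed
  ultimately show ?thesis
    by (simp add: finite_image_iff)
qed

section \<open>Row space and kernel\<close>

lemma subspace_range_matrix: "subspace (range (\<lambda>v. B *v v))"
  for B :: "real^'n^'m"
  by (intro linear_subspace_image subspace_UNIV matrix_vector_mul_linear)

text \<open>Pairing the left side with \<open>v\<close> gives the squared norm of
  \<open>B *v v\<close>.\<close>

lemma gram_eq_0_iff: "transpose B *v (B *v v) = 0 \<longleftrightarrow> B *v v = 0"
  for B :: "real^'n^'m"
  by (metis gram_inner inner_eq_zero_iff inner_zero_left matrix_vector_mult_0_right)

lemma range_transpose_Int_kernel:
  fixes B :: "real^'n^'m"
  assumes "v \<in> range (\<lambda>r. transpose B *v r)" "B *v v = 0"
  shows "v = 0"
  using assms by (metis inner_eq_zero_iff inner_zero_right rangeE transpose_inner)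

text \<open>Take for \<open>w\<close> the orthogonal projection of \<open>v\<close> onto the row
  space; what is orthogonal to the row space lies in the kernel.\<close>

lemma orthogonal_range_transpose_decomp:
  fixes B :: "real^'n^'m"
  obtains w where "w \<in> range (\<lambda>r. transpose B *v r)" "B *v (v - w) = 0"
proof -
  let ?W = "range (\<lambda>r. transpose B *v r)"
  obtain w z where wz: "w \<in> ?W" "\<And>u. u \<in> ?W \<Longrightarrow> orthogonal z u" "v = w + z"
    using orthogonal_subspace_decomp_exists[of ?W v] subspace_range_matrix[of "transpose B"]
    by (metis span_eq_iff)
  have "(B *v z) \<bullet> (B *v z) = z \<bullet> (transpose B *v (B *v z))"
    by (metis transpose_inner inner_commute)
  also have "\<dots> = 0"
    using wz(2) by (simp add: orthogonal_def)
  finally have "B *v (v - w) = 0"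
    using wz(3) by simp
  then show ?thesis using wz(1) that by blast
qed

section \<open>Bounds by the extremal singular values\<close>

text \<open>Minimising the quotient of the negated Gram operator over the vectors supported on
  \<open>C\<close> yields the largest eigenvalue \<open>- l\<close>. Its root is a singular value
  that bounds the operator norm, and \<open>sigma_max\<close> is at least that large.\<close>

lemma
  assumes "submatrix A R C \<noteq> 0"
  shows sigma_max_nonneg: "0 \<le> sigma_max A R C"
    and sigma_max_bound: "norm (submatrix A R C *v v) \<le> sigma_max A R C * norm v"
proof -
  let ?B = "submatrix A R C"
  let ?W = "{v. vec_restrict C v = v}"
  obtain c where c: "c \<in> C"
    using assms by (auto simp: submatrix_def vec_eq_iff split: if_splits)
  have "axis c 1 \<in> ?W" "axis c 1 \<noteq> (0 :: real^'a)"
    using c by (auto simp: vec_eq_iff axis_def)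
  then have ne: "?W \<noteq> {0}" by blast
  have sub: "subspace ?W"
    by (auto simp: subspace_def vec_eq_iff)
  have lin: "linear (\<lambda>v. - (transpose ?B *v (?B *v v)))"
    by (intro linear_compose_neg linear_compose[OF matrix_vector_mul_linear matrix_vector_mul_linear, unfolded o_def])
  have sym: "(- (transpose ?B *v (?B *v v))) \<bullet> w = v \<bullet> (- (transpose ?B *v (?B *v w)))" for v w
    by (simp add: gram_inner inner_commute[of v] inner_commute[of "?B *v v"])
  have inv: "(\<lambda>v. - (transpose ?B *v (?B *v v))) ` ?W \<subseteq> ?W"
    by (auto simp: transpose_submatrix_mult vec_restrict_minus)
  obtain l v where v: "v \<in> ?W" "v \<noteq> 0" "- (transpose ?B *v (?B *v v)) = l *\<^sub>R v"
    and l: "\<And>w. w \<in> ?W \<Longrightarrow> l * (norm w)\<^sup>2 \<le> (- (transpose ?B *v (?B *v w))) \<bullet> w"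
    by (rule extremal_eigenvector[OF lin sym sub inv ne]) blast
  have "l * (norm v)\<^sup>2 = - (norm (?B *v v))\<^sup>2"
    using arg_cong[OF v(3), of "\<lambda>x. x \<bullet> v"] by (simp add: gram_inner power2_norm_eq_inner)
  then have "l * (norm v)\<^sup>2 \<le> 0" by simp
  then have "l \<le> 0" using v(2) by (simp add: mult_le_0_iff)
  moreover have "transpose ?B *v (?B *v v) = (- l) *\<^sub>R v"
    using v(3) by (metis minus_minus scaleR_minus_left)
  ultimately have "sqrt (- l) \<in> singular_values A R C"
    unfolding singular_values_iff using v(1,2) by auto
  then have le: "sqrt (- l) \<le> sigma_max A R C"
    unfolding sigma_max_def by (intro Max_ge finite_singular_values)
  then show nn: "0 \<le> sigma_max A R C"
    using \<open>l \<le> 0\<close> by (meson neg_0_le_iff_le order_trans real_sqrt_ge_zero)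
  have sqrt_bound: "norm (?B *v w) \<le> sqrt (- l) * norm w" for w
  proof -
    have "(norm (?B *v w))\<^sup>2 = (norm (?B *v vec_restrict C w))\<^sup>2"
      by (simp add: submatrix_mult)
    also have "\<dots> \<le> - l * (norm (vec_restrict C w))\<^sup>2"
      using l[of "vec_restrict C w"] by (simp add: gram_inner power2_norm_eq_inner)
    also have "\<dots> \<le> - l * (norm w)\<^sup>2"
    proof (intro mult_left_mono)
      have "(norm (vec_restrict C w))\<^sup>2 \<le> (norm (vec_restrict UNIV w))\<^sup>2"
        unfolding norm_vec_restrict by (intro sum_mono2) auto
      then show "(norm (vec_restrict C w))\<^sup>2 \<le> (norm w)\<^sup>2" by simp
    qed (use \<open>l \<le> 0\<close> in simp)
    also have "\<dots> = (sqrt (- l) * norm w)\<^sup>2"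
      using \<open>l \<le> 0\<close> by (simp add: power_mult_distrib)
    finally show ?thesis
      using \<open>l \<le> 0\<close> by (simp add: power2_le_iff_abs_le)
  qed
  show "norm (?B *v v) \<le> sigma_max A R C * norm v" for v
    using sqrt_bound[of v] le by (meson mult_right_mono norm_ge_zero order_trans)
qed

text \<open>By Cauchy-Schwarz, the squared norm of \<open>transpose B *v r\<close> is at most
  \<open>norm r\<close> times the norm of \<open>B *v (transpose B *v r)\<close>; the bound for
  \<open>B\<close> applies to the latter and one factor cancels.\<close>

lemma sigma_max_bound_transpose:
  assumes "submatrix A R C \<noteq> 0"
  shows "norm (transpose (submatrix A R C) *v r) \<le> sigma_max A R C * norm r"
proof (cases "transpose (submatrix A R C) *v r = 0")
  case True
  then show ?thesis using sigma_max_nonneg[OF assms] by simp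
next
  case False
  let ?B = "submatrix A R C"
  have "(norm (transpose ?B *v r))\<^sup>2 = r \<bullet> (?B *v (transpose ?B *v r))"
    by (simp add: power2_norm_eq_inner transpose_inner)
  also have "\<dots> \<le> norm r * norm (?B *v (transpose ?B *v r))"
    by (rule norm_cauchy_schwarz)
  also have "\<dots> \<le> norm r * (sigma_max A R C * norm (transpose ?B *v r))"
    by (intro mult_left_mono sigma_max_bound assms) simp
  finally show ?thesis
    using False by (simp add: power2_eq_square mult.commute)
qed

text \<open>Here the Gram quotient is minimised over the row space. The block is injective there, so
  the minimum \<open>l\<close> is positive and \<open>sqrt l\<close> is a nonzero singular value,
  which \<open>sigma_min\<close> cannot exceed.\<close>

lemma
  assumes "submatrix A R C \<noteq> 0"
  shows sigma_min_pos: "0 < sigma_min A R C"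
    and sigma_min_bound: "v \<in> range (\<lambda>r. transpose (submatrix A R C) *v r) \<Longrightarrow>
      sigma_min A R C * norm v \<le> norm (submatrix A R C *v v)"
proof -
  let ?B = "submatrix A R C"
  let ?W = "range (\<lambda>r. transpose ?B *v r)"
  have ne: "?W \<noteq> {0}"
  proof
    assume *: "?W = {0}"
    have "?B *v v = 0" for v
    proof -
      have "transpose ?B *v (?B *v v) = 0" using * by blast
      then show ?thesis by (simp add: gram_eq_0_iff)
    qed
    then show False using assms by (metis matrix_eq matrix_vector_mult_0)
  qed
  have lin: "linear (\<lambda>v. transpose ?B *v (?B *v v))"
    by (intro linear_compose[OF matrix_vector_mul_linear matrix_vector_mul_linear, unfolded o_def])
  have sym: "(transpose ?B *v (?B *v v)) \<bullet> w = v \<bullet> (transpose ?B *v (?B *v w))" for v w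
    by (simp add: gram_inner inner_commute[of v] inner_commute[of "?B *v v"])
  have inv: "(\<lambda>v. transpose ?B *v (?B *v v)) ` ?W \<subseteq> ?W"
    by auto
  obtain l v where v: "v \<in> ?W" "v \<noteq> 0" "transpose ?B *v (?B *v v) = l *\<^sub>R v"
    and l: "\<And>w. w \<in> ?W \<Longrightarrow> l * (norm w)\<^sup>2 \<le> (transpose ?B *v (?B *v w)) \<bullet> w"
    by (rule extremal_eigenvector[OF lin sym subspace_range_matrix inv ne]) blast
  have "?B *v v \<noteq> 0"
    using range_transpose_Int_kernel[OF v(1)] v(2) by blast
  moreover have "l * (norm v)\<^sup>2 = (norm (?B *v v))\<^sup>2"
    using arg_cong[OF v(3), of "\<lambda>x. x \<bullet> v"] by (simp add: gram_inner power2_norm_eq_inner)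
  ultimately have "0 < l"
    by (metis norm_eq_zero zero_less_power2 zero_less_mult_pos2 v(2))
  moreover have "vec_restrict C v = v"
    using v(1) by (auto simp: transpose_submatrix_mult)
  ultimately have mem: "sqrt l \<in> singular_values A R C - {0}"
    unfolding Diff_iff singular_values_iff using v(2,3) by auto
  have fin: "finite (singular_values A R C - {0})"
    using finite_singular_values by blast
  have "sigma_min A R C \<in> singular_values A R C - {0}"
    unfolding sigma_min_def using fin mem by (intro Min_in) auto
  then show pos: "0 < sigma_min A R C"
    by (auto simp: singular_values_iff order_le_less)
  have "sigma_min A R C \<le> sqrt l"
    unfolding sigma_min_def using fin mem by (intro Min_le)
  moreover have "sqrt l * norm w \<le> norm (?B *v w)" if "w \<in> ?W" for w
  proof -
    have "(sqrt l * norm w)\<^sup>2 \<le> (norm (?B *v w))\<^sup>2"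
      using l[OF that] \<open>0 < l\<close> by (simp add: power_mult_distrib gram_inner power2_norm_eq_inner)
    then show ?thesis by (rule power2_le_imp_le) simp
  qed
  ultimately show "sigma_min A R C * norm w \<le> norm (?B *v w)" if "w \<in> ?W" for w
    using that by (meson mult_right_mono norm_ge_zero order_trans)
qed

text \<open>Write \<open>r = B *v w\<close> with \<open>w\<close> in the row space. Then
  \<open>(norm r)\<^sup>2 = (transpose B *v r) \<bullet> w\<close>, and Cauchy-Schwarz together with
  \<open>sigma_min_bound\<close> for \<open>w\<close> gives the claim after dividing by
  \<open>norm w\<close>.\<close>

lemma sigma_min_bound_transpose:
  assumes "submatrix A R C \<noteq> 0" and r: "r \<in> range (\<lambda>v. submatrix A R C *v v)"
  shows "sigma_min A R C * norm r \<le> norm (transpose (submatrix A R C) *v r)"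
proof -
  let ?B = "submatrix A R C"
  obtain v where v: "r = ?B *v v" using r by blast
  obtain w where w: "w \<in> range (\<lambda>r. transpose ?B *v r)" "?B *v (v - w) = 0"
    by (rule orthogonal_range_transpose_decomp)
  then have r_eq: "r = ?B *v w"
    using v by (simp add: matrix_vector_mult_diff_distrib)
  show ?thesis
  proof (cases "w = 0")
    case False
    have "sigma_min A R C * norm w * norm r \<le> norm r * norm r"
      using sigma_min_bound[OF assms(1) w(1)] r_eq by (intro mult_right_mono) auto
    also have "\<dots> = (transpose ?B *v r) \<bullet> w"
      using r_eq by (simp add: transpose_inner power2_norm_eq_inner flip: power2_eq_square)
    also have "\<dots> \<le> norm (transpose ?B *v r) * norm w"
      by (rule norm_cauchy_schwarz)
    finally show ?thesis
      using False by (simp add: mult.assoc mult.left_commute mult.commute[of _ "norm w"])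
  qed (simp add: r_eq)
qed

lemma sigma_max_pos:
  assumes "submatrix A R C \<noteq> 0"
  shows "0 < sigma_max A R C"
proof -
  obtain v where "submatrix A R C *v v \<noteq> 0"
    using assms by (metis matrix_eq matrix_vector_mult_0)
  then have "0 < sigma_max A R C * norm v"
    using sigma_max_bound[OF assms, of v] by (metis less_le_trans zero_less_norm_iff)
  then show ?thesis
    by (metis norm_ge_zero zero_less_mult_pos2 zero_less_norm_iff mult_zero_right norm_zero less_irrefl)
qed

section \<open>The Moore-Penrose pseudoinverse\<close>

text \<open>\<open>g y\<close> is the minimum-norm least-squares solution: the only vector of the
  row space that solves the normal equations for \<open>y\<close>. Uniqueness makes \<open>g\<close>
  linear, and its matrix satisfies the Penrose conditions.\<close>

lemma is_pinv_exists: "\<exists>X. is_pinv A X"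
proof -
  let ?W = "range (\<lambda>r. transpose A *v r)"
  have W: "subspace ?W" by (rule subspace_range_matrix)
  \<comment> \<open>Project \<open>y\<close> onto the column space, pick a preimage
    \<open>z\<close>, and replace \<open>z\<close> by its projection onto the row space.\<close>
  have ex: "\<exists>w. w \<in> ?W \<and> transpose A *v (A *v w - y) = 0" for y
  proof -
    obtain q where q: "q \<in> range (\<lambda>r. A *v r)" "transpose A *v (y - q) = 0"
      using orthogonal_range_transpose_decomp[of "transpose A" y] by auto
    then obtain z where z: "q = A *v z" by auto
    obtain w where w: "w \<in> ?W" "A *v (z - w) = 0"
      by (rule orthogonal_range_transpose_decomp)
    have "A *v w - y = - (y - q)"
      using w(2) z by (simp add: matrix_vector_mult_diff_distrib)
    then have "transpose A *v (A *v w - y) = 0"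
      using q(2) by (simp add: matrix_vector_mult_diff_distrib)
    then show ?thesis using w(1) by blast
  qed
  have uniq: "w = w'" if "w \<in> ?W" "w' \<in> ?W" "transpose A *v (A *v w - A *v w') = 0" for w w'
  proof -
    have "A *v (w - w') = 0"
      using that(3) gram_eq_0_iff[of A "w - w'"] by (simp add: matrix_vector_mult_diff_distrib)
    then have "w - w' = 0"
      using that W by (intro range_transpose_Int_kernel[of _ A] subspace_diff)
    then show ?thesis by simp
  qed
  obtain g where g: "\<And>y. g y \<in> ?W" "\<And>y. transpose A *v (A *v g y - y) = 0"
  proof -
    have "\<forall>y. \<exists>w. w \<in> ?W \<and> transpose A *v (A *v w - y) = 0"
      using ex by blast
    from choice[OF this] show ?thesis using that by blast
  qed
  have g': "transpose A *v (A *v g y) = transpose A *v y" for y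
    using g(2)[of y] unfolding matrix_vector_mult_diff_distrib right_minus_eq .
  have "linear g"
  proof (rule linearI)
    show "g (y + z) = g y + g z" for y z
    proof (rule uniq)
      show "g y + g z \<in> ?W" using g(1) W by (intro subspace_add)
    qed (simp_all add: g(1) g' matrix_vector_mult_diff_distrib matrix_vector_right_distrib)
    show "g (c *\<^sub>R y) = c *\<^sub>R g y" for c y
    proof (rule uniq)
      show "c *\<^sub>R g y \<in> ?W" using g(1) W by (intro subspace_scale)
    qed (simp_all add: g(1) g' matrix_vector_mult_diff_distrib matrix_vector_mult_scaleR)
  qed
  define X where "X = matrix g"
  have X: "X *v y = g y" for y
    unfolding X_def using \<open>linear g\<close> by (simp add: matrix_works)
  have AX: "A *v (X *v (A *v v)) = A *v v" for v
    using gram_eq_0_iff[of A "g (A *v v) - v"] g'[of "A *v v"]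
    by (simp add: X matrix_vector_mult_diff_distrib)
  have XA: "X *v (A *v (X *v y)) = X *v y" for y
    unfolding X by (rule uniq[OF g(1) g(1)]) (simp add: g' matrix_vector_mult_diff_distrib)
  \<comment> \<open>\<open>A ** X\<close> is the orthogonal projector onto the column space; below,
    \<open>X ** A\<close> is the one onto the row space.\<close>
  have sym1: "transpose (A ** X) = A ** X"
  proof -
    have "(A *v g y) \<bullet> z = (A *v g y) \<bullet> (A *v g z)" for y z
      using g'[of z] by (metis transpose_inner inner_commute)
    then have "(A *v (X *v y)) \<bullet> z = y \<bullet> (A *v (X *v z))" for y z
      unfolding X by (metis inner_commute)
    then show ?thesis
      by (metis (no_types, lifting) matrix_eq matrix_vector_mul_assoc transpose_inner vector_eq_rdot)
  qed
  have sym2: "transpose (X ** A) = X ** A"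
  proof -
    have "(g (A *v v)) \<bullet> u = (g (A *v v)) \<bullet> (g (A *v u))" for v u
    proof -
      obtain r where r: "g (A *v v) = transpose A *v r" using g(1) by blast
      show ?thesis using AX[of u] unfolding r X transpose_inner by simp
    qed
    then have "(X *v (A *v v)) \<bullet> u = v \<bullet> (X *v (A *v u))" for v u
      unfolding X by (metis inner_commute)
    then show ?thesis
      by (metis (no_types, lifting) matrix_eq matrix_vector_mul_assoc transpose_inner vector_eq_rdot)
  qed
  have "A ** X ** A = A" "X ** A ** X = X"
    using AX XA by (simp_all add: matrix_eq flip: matrix_vector_mul_assoc)
  then show ?thesis
    unfolding is_pinv_def using sym1 sym2 by blast
qed

text \<open>\<open>A ** X\<close> and \<open>A ** Y\<close> are symmetric and absorb each other,
  hence agree; likewise \<open>X ** A\<close> and \<open>Y ** A\<close>. Then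
  \<open>X = X ** A ** X\<close> turns into \<open>Y ** A ** Y = Y\<close>.\<close>

lemma is_pinv_unique:
  assumes "is_pinv A X" "is_pinv A Y"
  shows "X = Y"
proof -
  note X = assms(1)[unfolded is_pinv_def] and Y = assms(2)[unfolded is_pinv_def]
  have "A ** X = transpose (A ** X)" using X by simp
  also have "\<dots> = transpose (A ** Y ** A ** X)" using Y by simp
  also have "\<dots> = transpose (A ** X) ** transpose (A ** Y)"
    by (simp add: matrix_transpose_mul matrix_mul_assoc)
  also have "\<dots> = A ** Y" using X Y by (simp add: matrix_mul_assoc)
  finally have AX: "A ** X = A ** Y" .
  have "X ** A = transpose (X ** A)" using X by simp
  also have "\<dots> = transpose (X ** (A ** Y ** A))" using Y by simp
  also have "\<dots> = transpose (Y ** A) ** transpose (X ** A)"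
    by (simp add: matrix_transpose_mul matrix_mul_assoc)
  also have "\<dots> = Y ** (A ** X ** A)" using X Y by (metis matrix_mul_assoc)
  finally have XA: "X ** A = Y ** A" using X by simp
  have "X = X ** A ** X" using X by simp
  also have "\<dots> = Y ** (A ** X)" using XA by (simp add: matrix_mul_assoc)
  also have "\<dots> = Y" using AX Y by (simp add: matrix_mul_assoc)
  finally show ?thesis .
qed

lemma is_pinv_pinv: "is_pinv A (pinv A)"
  unfolding pinv_def using is_pinv_exists is_pinv_unique by (metis theI)

text \<open>Puts the limit point into the row space, so that errors of row-space iterates stay where
  \<open>sigma_min_bound\<close> applies.\<close>

lemma pinv_mult_in_range: "pinv A *v b \<in> range (\<lambda>r. transpose A *v r)"
proof -
  have "pinv A = transpose (pinv A ** A) ** pinv A"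
    using is_pinv_pinv[of A] by (simp add: is_pinv_def)
  then have "pinv A *v b = transpose A *v (transpose (pinv A) *v (pinv A *v b))"
    by (metis matrix_transpose_mul matrix_vector_mul_assoc)
  then show ?thesis by blast
qed

text \<open>The normal equations, obtained by transposing \<open>A ** pinv A ** A = A\<close> and
  using the symmetry of \<open>A ** pinv A\<close>.\<close>

lemma transpose_pinv_residual: "transpose A *v (b - A *v (pinv A *v b)) = 0"
proof -
  have "transpose A ** (A ** pinv A) = transpose A"
    using is_pinv_pinv[of A] by (metis is_pinv_def matrix_transpose_mul)
  then show ?thesis
    by (simp add: matrix_vector_mult_diff_distrib matrix_vector_mul_assoc)
qed

section \<open>Mean error of one step\<close>

text \<open>The search vector of the method is \<open>- g\<close>; the sign enters the correction
  twice and cancels.\<close>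

lemma y_step_eq:
  fixes A :: "real^'n^'m" and S :: "'n set" and y :: "real^'m"
  defines "B \<equiv> submatrix A UNIV S"
  defines "g \<equiv> transpose B *v y"
  shows "y_step A S y = y - ((norm g)\<^sup>2 / (norm (B *v g))\<^sup>2) *\<^sub>R (B *v g)"
proof -
  have "column l A \<bullet> y = (transpose A *v y) $ l" for l
    by (simp add: column_def inner_vec_def transpose_def matrix_vector_mult_def)
  then have "(\<Sum>l\<in>S. (- (column l A \<bullet> y)) *\<^sub>R (axis l 1 :: real^'n)) = - g"
    unfolding g_def B_def transpose_submatrix_mult vec_restrict_UNIV
    by (simp add: vec_restrict_eq_sum sum_negf)
  moreover have "g = vec_restrict S (transpose A *v y)"
    by (simp add: g_def B_def transpose_submatrix_mult)
  moreover from this have "g \<bullet> (transpose A *v y) = (norm g)\<^sup>2"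
    by (simp add: inner_vec_restrict[of S "transpose A *v y" "transpose A *v y"] power2_norm_eq_inner)
  moreover have "A *v g = B *v g"
    using \<open>g = vec_restrict S (transpose A *v y)\<close> by (simp add: B_def submatrix_mult)
  moreover have "A *v (- g) = - (A *v g)"
    using matrix_vector_mult_diff_distrib[of A 0 g] by simp
  ultimately show ?thesis
    unfolding y_step_def Let_def by simp
qed

lemma x_step_eq:
  fixes A :: "real^'n^'m" and S :: "'m set" and b y :: "real^'m" and x :: "real^'n"
  defines "B \<equiv> submatrix A S UNIV"
  defines "r \<equiv> vec_restrict S (b - y - A *v x)"
  shows "x_step A b S y x = x + ((norm r)\<^sup>2 / (norm (transpose B *v r))\<^sup>2) *\<^sub>R (transpose B *v r)"
proof -
  have "row l A \<bullet> x = (A *v x) $ l" for l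
    by (simp add: row_def inner_vec_def matrix_vector_mult_def)
  then have "(\<Sum>l\<in>S. (b $ l - y $ l - row l A \<bullet> x) *\<^sub>R (axis l 1 :: real^'m)) = r"
    unfolding r_def by (simp add: vec_restrict_eq_sum)
  moreover have "r \<bullet> (b - y - A *v x) = (norm r)\<^sup>2"
    unfolding r_def by (simp add: inner_vec_restrict[of S "b - y - A *v x" "b - y - A *v x"] power2_norm_eq_inner)
  moreover have "transpose A *v r = transpose B *v r"
    by (simp add: B_def r_def transpose_submatrix_mult)
  ultimately show ?thesis
    unfolding x_step_def Let_def by simp
qed

lemma y_step_diff_in_range: "y_step A S y - y \<in> range (\<lambda>v. A *v v)"
proof -
  have "y_step A S y - y = A *v (- (((\<Sum>l\<in>S. (- (column l A \<bullet> y)) *\<^sub>R axis l 1) \<bullet> (transpose A *v y)) /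
    (norm (A *v (\<Sum>l\<in>S. (- (column l A \<bullet> y)) *\<^sub>R axis l 1)))\<^sup>2) *\<^sub>R (\<Sum>l\<in>S. (- (column l A \<bullet> y)) *\<^sub>R axis l 1))"
    unfolding y_step_def Let_def by (simp only: matrix_vector_mult_scaleR) simp
  then show ?thesis by (rule range_eqI)
qed

lemma x_step_diff_in_range: "x_step A b S y x - x \<in> range (\<lambda>v. transpose A *v v)"
  unfolding x_step_def Let_def
  by (simp flip: matrix_vector_mult_scaleR)

section \<open>Error reduction for a fixed block\<close>

text \<open>The step length makes the new error orthogonal to \<open>B *v g\<close>, so the decrease
  follows from Pythagoras. The vector \<open>bN\<close> does not affect \<open>g\<close>, being
  orthogonal to the range of \<open>A\<close>.\<close>

lemma y_step_error:
  fixes A :: "real^'n^'m"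
  assumes bN: "transpose A *v bN = 0" and nz: "submatrix A UNIV S \<noteq> 0"
  shows "(norm (y_step A S y - bN))\<^sup>2 \<le> (norm (y - bN))\<^sup>2 -
    (norm (vec_restrict S (transpose A *v (y - bN))))\<^sup>2 / (sigma_max A UNIV S)\<^sup>2"
proof -
  define B where "B = submatrix A UNIV S"
  define e where "e = y - bN"
  define g where "g = transpose B *v e"
  have g: "g = vec_restrict S (transpose A *v e)"
    by (simp add: g_def B_def transpose_submatrix_mult)
  have "transpose B *v y = g"
    using bN by (simp add: g e_def B_def transpose_submatrix_mult matrix_vector_mult_diff_distrib)
  then have step: "y_step A S y - bN = e - ((norm g)\<^sup>2 / (norm (B *v g))\<^sup>2) *\<^sub>R (B *v g)"
    by (simp add: y_step_eq e_def B_def)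
  have eg: "e \<bullet> (B *v g) = (norm g)\<^sup>2"
    by (metis g_def power2_norm_eq_inner transpose_inner)
  have bound: "norm (B *v g) \<le> sigma_max A UNIV S * norm g"
    unfolding B_def by (rule sigma_max_bound[OF nz])
  show ?thesis
  proof (cases "B *v g = 0")
    \<comment> \<open>Then \<open>eg\<close> gives \<open>g = 0\<close>, and both sides equal the
      old squared error.\<close>
    case True
    then show ?thesis using step eg by (simp flip: e_def g)
  next
    case False
    then have pos: "norm (B *v g) > 0" "norm g > 0" using bound by auto
    have sp: "sigma_max A UNIV S > 0"
      using bound pos by (metis less_le_trans zero_less_mult_pos2)
    have "(norm (y_step A S y - bN))\<^sup>2 = (norm e)\<^sup>2 - ((norm g)\<^sup>2)\<^sup>2 / (norm (B *v g))\<^sup>2"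
    proof -
      define c where "c = (norm g)\<^sup>2 / (norm (B *v g))\<^sup>2"
      have "c * ((B *v g) \<bullet> (B *v g)) = (norm g)\<^sup>2"
        using pos by (simp add: c_def power2_norm_eq_inner)
      then have c: "c * (c * ((B *v g) \<bullet> (B *v g))) = c * (norm g)\<^sup>2" by simp
      have "(norm (y_step A S y - bN))\<^sup>2 = e \<bullet> e - 2 * (c * (e \<bullet> (B *v g))) + c * (c * ((B *v g) \<bullet> (B *v g)))"
        unfolding step c_def[symmetric] power2_norm_eq_inner[of "_ - _"]
        by (simp add: inner_diff_left inner_diff_right inner_commute[of "B *v g" e] algebra_simps)
      also have "\<dots> = (norm e)\<^sup>2 - c * (norm g)\<^sup>2"
        unfolding c eg by (simp add: power2_norm_eq_inner)
      finally show ?thesis by (simp add: c_def power2_eq_square)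
    qed
    also have "\<dots> \<le> (norm e)\<^sup>2 - (norm g)\<^sup>2 / (sigma_max A UNIV S)\<^sup>2"
    proof -
      have "(norm (B *v g))\<^sup>2 \<le> (sigma_max A UNIV S)\<^sup>2 * (norm g)\<^sup>2"
        using power_mono[OF bound, of 2] by (simp add: power_mult_distrib)
      then have "(norm g)\<^sup>2 * (norm (B *v g))\<^sup>2 \<le> (norm g)\<^sup>2 * ((sigma_max A UNIV S)\<^sup>2 * (norm g)\<^sup>2)"
        by (rule mult_left_mono) simp
      then have "(norm g)\<^sup>2 / (sigma_max A UNIV S)\<^sup>2 \<le> ((norm g)\<^sup>2)\<^sup>2 / (norm (B *v g))\<^sup>2"
        using pos sp by (simp add: divide_simps power2_eq_square[of "(norm g)\<^sup>2"] mult.commute mult.left_commute)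
      then show ?thesis by simp
    qed
    finally show ?thesis by (simp flip: e_def g)
  qed
qed

lemma x_step_error:
  fixes A :: "real^'n^'m" and x :: "real^'n"
  assumes b: "b = bN + A *v xs" and nz: "submatrix A S UNIV \<noteq> 0"
    and y: "y - bN \<in> range (\<lambda>v. A *v v)"
  shows "(norm (x_step A b S y x - xs))\<^sup>2 \<le> (norm (x - xs))\<^sup>2
    - (norm (vec_restrict S (A *v (x - xs))))\<^sup>2 / (sigma_max A S UNIV)\<^sup>2
    + (norm (vec_restrict S (y - bN)))\<^sup>2 / (sigma_min A S UNIV)\<^sup>2"
proof -
  define B where "B = submatrix A S UNIV"
  define u where "u = x - xs"
  define e where "e = vec_restrict S (y - bN)"
  define r where "r = vec_restrict S (b - y - A *v x)"
  define h where "h = transpose B *v r"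
  have Bu: "B *v u = vec_restrict S (A *v u)"
    by (simp add: B_def submatrix_mult)
  have r: "r = - (B *v u) - e"
    unfolding r_def Bu e_def unfolding u_def b
    by (simp add: vec_eq_iff matrix_vector_mult_diff_distrib)
  \<comment> \<open>This places \<open>e\<close>, hence \<open>r\<close>, in the range of the block,
    without which \<open>sigma_min\<close> gives no lower bound for \<open>norm h\<close>.\<close>
  obtain z where "y - bN = A *v z" using y by blast
  then have "e = B *v z"
    by (simp add: e_def B_def submatrix_mult)
  then have "r = B *v (- u - z)"
    using matrix_vector_mult_diff_distrib[of B 0 u] by (simp add: r matrix_vector_mult_diff_distrib)
  then have "r \<in> range (\<lambda>v. B *v v)" by blast
  then have lower: "sigma_min A S UNIV * norm r \<le> norm h"
    unfolding h_def B_def by (intro sigma_min_bound_transpose nz)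
  have upper: "norm h \<le> sigma_max A S UNIV * norm r"
    unfolding h_def B_def by (intro sigma_max_bound_transpose nz)
  have minpos: "sigma_min A S UNIV > 0"
    by (rule sigma_min_pos[OF nz])
  have step: "x_step A b S y x - xs = u + ((norm r)\<^sup>2 / (norm h)\<^sup>2) *\<^sub>R h"
    by (simp add: x_step_eq u_def h_def B_def r_def)
  define \<alpha> where "\<alpha> = (norm r)\<^sup>2 / (norm h)\<^sup>2"
  have main: "(norm (x_step A b S y x - xs))\<^sup>2 \<le>
    (norm u)\<^sup>2 - (norm (B *v u))\<^sup>2 / (sigma_max A S UNIV)\<^sup>2 + (norm e)\<^sup>2 / (sigma_min A S UNIV)\<^sup>2"
  proof (cases "r = 0")
    \<comment> \<open>Nothing moves and \<open>B *v u = - e\<close>, so the claim reduces to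
      \<open>sigma_min\<close> being at most \<open>sigma_max\<close>. This is read off from both
      transpose bounds at one nonzero vector \<open>B *v v\<close>.\<close>
    case True
    then have Bue: "e = - (B *v u)" using r by simp
    have "sigma_min A S UNIV \<le> sigma_max A S UNIV"
    proof -
      obtain v where v: "B *v v \<noteq> 0"
        using nz unfolding B_def by (metis matrix_eq matrix_vector_mult_0)
      then have "norm (B *v v) > 0" by simp
      moreover have "sigma_min A S UNIV * norm (B *v v) \<le> sigma_max A S UNIV * norm (B *v v)"
        using sigma_min_bound_transpose[OF nz, of "B *v v"] sigma_max_bound_transpose[OF nz, of "B *v v"]
        by (auto simp: B_def intro: order_trans)
      ultimately show ?thesis by simp
    qed
    then have "(norm e)\<^sup>2 / (sigma_max A S UNIV)\<^sup>2 \<le> (norm e)\<^sup>2 / (sigma_min A S UNIV)\<^sup>2"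
      using minpos by (intro divide_left_mono power_mono mult_pos_pos) auto
    then show ?thesis
      using step True by (simp add: Bue)
  next
    case False
    then have rpos: "norm r > 0" by simp
    then have hpos: "norm h > 0"
      using lower minpos by (metis less_le_trans mult_pos_pos)
    have maxpos: "sigma_max A S UNIV > 0"
      using upper hpos rpos by (metis less_le_trans zero_less_mult_pos2)
    have uh: "u \<bullet> h = (B *v u) \<bullet> r"
      by (metis h_def inner_commute transpose_inner)
    have \<alpha>h: "\<alpha> * (h \<bullet> h) = r \<bullet> r"
      using hpos by (simp add: \<alpha>_def power2_norm_eq_inner)
    have "(norm (x_step A b S y x - xs))\<^sup>2 = u \<bullet> u + 2 * \<alpha> * (u \<bullet> h) + \<alpha> * (\<alpha> * (h \<bullet> h))"
      unfolding step power2_norm_eq_inner[of "_ + _"] \<alpha>_def[symmetric]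
      by (simp add: inner_add_left inner_add_right inner_commute[of h u] algebra_simps)
    \<comment> \<open>Substituting \<open>r = - (B *v u) - e\<close> cancels the mixed terms. The
      two remaining terms have opposite signs, so one needs the lower and the other the upper bound
      on \<open>\<alpha>\<close>.\<close>
    also have "\<dots> = u \<bullet> u - \<alpha> * ((B *v u) \<bullet> (B *v u)) + \<alpha> * (e \<bullet> e)"
    proof -
      have ur: "(B *v u) \<bullet> r = - ((B *v u) \<bullet> (B *v u)) - (B *v u) \<bullet> e"
        by (simp add: r inner_diff_right)
      have rr: "r \<bullet> r = (B *v u) \<bullet> (B *v u) + 2 * ((B *v u) \<bullet> e) + e \<bullet> e"
        by (simp add: r inner_diff_left inner_diff_right inner_commute[of e "B *v u"])
      show ?thesis
        unfolding \<alpha>h uh ur rr by (simp add: algebra_simps)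
    qed
    also have "\<dots> = (norm u)\<^sup>2 - \<alpha> * (norm (B *v u))\<^sup>2 + \<alpha> * (norm e)\<^sup>2"
      by (simp add: power2_norm_eq_inner)
    also have "\<dots> \<le> (norm u)\<^sup>2 - 1 / (sigma_max A S UNIV)\<^sup>2 * (norm (B *v u))\<^sup>2
        + 1 / (sigma_min A S UNIV)\<^sup>2 * (norm e)\<^sup>2"
    proof (intro add_mono diff_mono mult_right_mono order_refl)
      show "1 / (sigma_max A S UNIV)\<^sup>2 \<le> \<alpha>"
        using power_mono[OF upper, of 2] hpos maxpos
        by (simp add: \<alpha>_def field_simps power_mult_distrib)
      show "\<alpha> \<le> 1 / (sigma_min A S UNIV)\<^sup>2"
        using power_mono[OF lower, of 2] hpos minpos
        by (simp add: \<alpha>_def field_simps power_mult_distrib)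
    qed auto
    finally show ?thesis by simp
  qed
  then show ?thesis
    unfolding Bu unfolding e_def u_def .
qed

section \<open>Averaging over the blocks\<close>

text \<open>Each summand equals \<open>(g i / T) / (\<sigma> i / F i)\<close>: a selection
  probability proportional to \<open>F i\<close> leaves only the ratio that the maximum
  bounds.\<close>

lemma weighted_sum_ge_Max:
  fixes F \<sigma> g :: "'i \<Rightarrow> real"
  assumes N: "finite N" and pos: "\<And>i. i \<in> N \<Longrightarrow> 0 < F i" "\<And>i. i \<in> N \<Longrightarrow> 0 < \<sigma> i" "\<And>i. i \<in> N \<Longrightarrow> 0 \<le> g i"
    and T: "0 < T"
  shows "1 / Max ((\<lambda>i. \<sigma> i / F i) ` N) * ((\<Sum>i\<in>N. g i) / T) \<le> (\<Sum>i\<in>N. F i / T * (g i / \<sigma> i))"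
proof -
  have "1 / Max ((\<lambda>i. \<sigma> i / F i) ` N) * (g i / T) \<le> F i / T * (g i / \<sigma> i)" if i: "i \<in> N" for i
  proof -
    have "1 / Max ((\<lambda>i. \<sigma> i / F i) ` N) \<le> 1 / (\<sigma> i / F i)"
    proof (rule divide_left_mono)
      have "0 < Max ((\<lambda>i. \<sigma> i / F i) ` N)"
        using N i pos by (subst Max_gr_iff) auto
      then show "0 < Max ((\<lambda>i. \<sigma> i / F i) ` N) * (\<sigma> i / F i)"
        using pos i by simp
    qed (use N i in \<open>auto intro!: Max_ge\<close>)
    then have "1 / Max ((\<lambda>i. \<sigma> i / F i) ` N) * (g i / T) \<le> 1 / (\<sigma> i / F i) * (g i / T)"
      using pos(3)[OF i] T by (intro mult_right_mono) auto
    then show ?thesis by (simp add: field_simps)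
  qed
  then have "(\<Sum>i\<in>N. 1 / Max ((\<lambda>i. \<sigma> i / F i) ` N) * (g i / T)) \<le> (\<Sum>i\<in>N. F i / T * (g i / \<sigma> i))"
    by (rule sum_mono)
  then show ?thesis
    by (simp add: sum_distrib_left sum_divide_distrib)
qed

lemma weighted_sum_le_Min:
  fixes F \<sigma> g :: "'i \<Rightarrow> real"
  assumes N: "finite N" and pos: "\<And>i. i \<in> N \<Longrightarrow> 0 < F i" "\<And>i. i \<in> N \<Longrightarrow> 0 < \<sigma> i" "\<And>i. i \<in> N \<Longrightarrow> 0 \<le> g i"
    and T: "0 < T"
  shows "(\<Sum>i\<in>N. F i / T * (g i / \<sigma> i)) \<le> (\<Sum>i\<in>N. g i) / (T * Min ((\<lambda>i. \<sigma> i / F i) ` N))"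
proof -
  have "F i / T * (g i / \<sigma> i) \<le> g i / (T * Min ((\<lambda>i. \<sigma> i / F i) ` N))" if i: "i \<in> N" for i
  proof -
    have "g i / T / (\<sigma> i / F i) \<le> g i / T / Min ((\<lambda>i. \<sigma> i / F i) ` N)"
    proof (rule divide_left_mono)
      have "0 < Min ((\<lambda>i. \<sigma> i / F i) ` N)"
        using N i pos by (subst Min_gr_iff) auto
      then show "0 < \<sigma> i / F i * Min ((\<lambda>i. \<sigma> i / F i) ` N)"
        using pos i by simp
    qed (use N i pos T in \<open>auto intro!: Min_le\<close>)
    then show ?thesis by (simp add: field_simps)
  qed
  then have "(\<Sum>i\<in>N. F i / T * (g i / \<sigma> i)) \<le> (\<Sum>i\<in>N. g i / (T * Min ((\<lambda>i. \<sigma> i / F i) ` N)))"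
    by (rule sum_mono)
  then show ?thesis
    by (simp add: sum_divide_distrib)
qed

lemma sum_frob_norm_rows:
  fixes A :: "real^'n^'m"
  assumes "disjoint_family_on I N" "(\<Union>i\<in>N. I i) = UNIV" "finite N"
  shows "(\<Sum>i\<in>N. (frob_norm A (I i) C)\<^sup>2) = (frob_norm A UNIV C)\<^sup>2"
  unfolding frob_norm_sq assms(2)[symmetric]
  using assms by (intro sum.UNION_disjoint[symmetric]) (auto simp: disjoint_family_on_def)

lemma sum_frob_norm_cols:
  fixes A :: "real^'n^'m"
  assumes "disjoint_family_on J N" "(\<Union>j\<in>N. J j) = UNIV" "finite N"
  shows "(\<Sum>j\<in>N. (frob_norm A R (J j))\<^sup>2) = (frob_norm A R UNIV)\<^sup>2"
proof -
  have "(\<Sum>c\<in>UNIV. \<Sum>r\<in>R. (A $ r $ c)\<^sup>2) = (\<Sum>j\<in>N. \<Sum>c\<in>J j. \<Sum>r\<in>R. (A $ r $ c)\<^sup>2)"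
    unfolding assms(2)[symmetric]
    using assms by (intro sum.UNION_disjoint) (auto simp: disjoint_family_on_def)
  then show ?thesis
    unfolding frob_norm_sq by (simp add: sum.swap[of _ R])
qed

text \<open>The block gradients add up to the full \<open>transpose A *v e\<close>, which is bounded
  below by \<open>sigma_min\<close> because \<open>e\<close> lies in the range of
  \<open>A\<close>.\<close>

lemma y_step_mean_error:
  fixes A :: "real^'n^'m"
  assumes J: "disjoint_family_on J {1..t}" "(\<Union>j\<in>{1..t}. J j) = UNIV"
    and nz: "\<And>j. j \<in> {1..t} \<Longrightarrow> submatrix A UNIV (J j) \<noteq> 0" "A \<noteq> 0"
    and bN: "transpose A *v bN = 0" and y: "y - bN \<in> range (\<lambda>v. A *v v)"
  shows "(\<Sum>j\<in>{1..t}. (frob_norm A UNIV (J j))\<^sup>2 / (frob_norm A UNIV UNIV)\<^sup>2 * (norm (y_step A (J j) y - bN))\<^sup>2)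
    \<le> (1 - 1 / beta_max_cols A t J * ((sigma_min A UNIV UNIV)\<^sup>2 / (frob_norm A UNIV UNIV)\<^sup>2)) * (norm (y - bN))\<^sup>2"
proof -
  let ?N = "{1..t}"
  define F where "F j = (frob_norm A UNIV (J j))\<^sup>2" for j
  define T where "T = (frob_norm A UNIV UNIV)\<^sup>2"
  define e where "e = y - bN"
  define g where "g j = (norm (vec_restrict (J j) (transpose A *v e)))\<^sup>2" for j
  define \<sigma> where "\<sigma> j = (sigma_max A UNIV (J j))\<^sup>2" for j
  have T: "T > 0" unfolding T_def using nz(2) by (intro frob_norm_pos) simp
  have F: "F j > 0" if "j \<in> ?N" for j
    unfolding F_def using nz(1)[OF that] by (rule frob_norm_pos)
  have \<sigma>: "\<sigma> j > 0" if "j \<in> ?N" for j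
    unfolding \<sigma>_def using sigma_max_pos[OF nz(1)[OF that]] by simp
  have sumF: "(\<Sum>j\<in>?N. F j) = T"
    unfolding F_def T_def by (rule sum_frob_norm_cols[OF J]) simp
  have sumg: "(\<Sum>j\<in>?N. g j) = (norm (transpose A *v e))\<^sup>2"
    unfolding g_def by (rule sum_norm_vec_restrict[OF J]) simp
  have beta: "beta_max_cols A t J = Max ((\<lambda>j. \<sigma> j / F j) ` ?N)"
    by (simp add: beta_max_cols_def \<sigma>_def F_def)
  have "?N \<noteq> {}" using J(2) by auto
  then have betapos: "0 < beta_max_cols A t J"
    unfolding beta using F \<sigma> by (subst Max_gr_iff) auto
  have "(\<Sum>j\<in>?N. F j / T * (norm (y_step A (J j) y - bN))\<^sup>2) \<le> (\<Sum>j\<in>?N. F j / T * ((norm e)\<^sup>2 - g j / \<sigma> j))"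
  proof (intro sum_mono mult_left_mono)
    fix j assume j: "j \<in> ?N"
    show "(norm (y_step A (J j) y - bN))\<^sup>2 \<le> (norm e)\<^sup>2 - g j / \<sigma> j"
      using y_step_error[OF bN nz(1)[OF j], of y] by (simp add: e_def g_def \<sigma>_def)
  qed (use F T in \<open>auto intro!: divide_nonneg_nonneg intro: less_imp_le\<close>)
  also have "\<dots> = (\<Sum>j\<in>?N. F j / T) * (norm e)\<^sup>2 - (\<Sum>j\<in>?N. F j / T * (g j / \<sigma> j))"
    by (simp add: right_diff_distrib sum_subtractf sum_distrib_right)
  also have "(\<Sum>j\<in>?N. F j / T) = 1"
    using sumF T by (simp flip: sum_divide_distrib)
  also have "1 * (norm e)\<^sup>2 - (\<Sum>j\<in>?N. F j / T * (g j / \<sigma> j))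
      \<le> (norm e)\<^sup>2 - 1 / beta_max_cols A t J * ((sigma_min A UNIV UNIV)\<^sup>2 * (norm e)\<^sup>2 / T)"
  proof -
    have "sigma_min A UNIV UNIV * norm e \<le> norm (transpose A *v e)"
      using sigma_min_bound_transpose[of A UNIV UNIV e] nz(2) y by (simp add: e_def)
    then have "(sigma_min A UNIV UNIV)\<^sup>2 * (norm e)\<^sup>2 \<le> (\<Sum>j\<in>?N. g j)"
      unfolding sumg using sigma_min_pos[of A UNIV UNIV] nz(2)
      by (metis power_mono power_mult_distrib submatrix_UNIV mult_nonneg_nonneg less_imp_le norm_ge_zero)
    then have "1 / beta_max_cols A t J * ((sigma_min A UNIV UNIV)\<^sup>2 * (norm e)\<^sup>2 / T) \<le> 1 / beta_max_cols A t J * ((\<Sum>j\<in>?N. g j) / T)"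
      using betapos T by (intro mult_left_mono divide_right_mono) auto
    also have "\<dots> \<le> (\<Sum>j\<in>?N. F j / T * (g j / \<sigma> j))"
      unfolding beta by (rule weighted_sum_ge_Max) (use F \<sigma> T in \<open>auto simp: g_def\<close>)
    finally show ?thesis by simp
  qed
  finally show ?thesis
    by (simp add: F_def T_def e_def algebra_simps)
qed

text \<open>Here \<open>y\<close> stands for the vector after the column update of the same step.
  The block parts of \<open>A *v u\<close> and of \<open>e\<close> are summed separately, and
  \<open>sigma_min\<close> applies since \<open>u\<close> lies in the row space.\<close>

lemma x_step_mean_error:
  fixes A :: "real^'n^'m" and x :: "real^'n"
  assumes I: "disjoint_family_on I {1..s}" "(\<Union>i\<in>{1..s}. I i) = UNIV"
    and nz: "\<And>i. i \<in> {1..s} \<Longrightarrow> submatrix A (I i) UNIV \<noteq> 0" "A \<noteq> 0"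
    and b: "b = bN + A *v xs" and y: "y - bN \<in> range (\<lambda>v. A *v v)"
    and x: "x - xs \<in> range (\<lambda>v. transpose A *v v)"
  shows "(\<Sum>i\<in>{1..s}. (frob_norm A (I i) UNIV)\<^sup>2 / (frob_norm A UNIV UNIV)\<^sup>2 * (norm (x_step A b (I i) y x - xs))\<^sup>2)
    \<le> (1 - 1 / beta_max_rows A s I * ((sigma_min A UNIV UNIV)\<^sup>2 / (frob_norm A UNIV UNIV)\<^sup>2)) * (norm (x - xs))\<^sup>2
      + (norm (y - bN))\<^sup>2 / ((frob_norm A UNIV UNIV)\<^sup>2 * beta_min_rows A s I)"
proof -
  let ?N = "{1..s}"
  define F where "F i = (frob_norm A (I i) UNIV)\<^sup>2" for i
  define T where "T = (frob_norm A UNIV UNIV)\<^sup>2"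
  define u where "u = x - xs"
  define e where "e = y - bN"
  define g where "g i = (norm (vec_restrict (I i) (A *v u)))\<^sup>2" for i
  define h where "h i = (norm (vec_restrict (I i) e))\<^sup>2" for i
  define \<sigma> where "\<sigma> i = (sigma_max A (I i) UNIV)\<^sup>2" for i
  define \<tau> where "\<tau> i = (sigma_min A (I i) UNIV)\<^sup>2" for i
  have T: "T > 0" unfolding T_def using nz(2) by (intro frob_norm_pos) simp
  have F: "F i > 0" if "i \<in> ?N" for i
    unfolding F_def using nz(1)[OF that] by (rule frob_norm_pos)
  have \<sigma>: "\<sigma> i > 0" if "i \<in> ?N" for i
    unfolding \<sigma>_def using sigma_max_pos[OF nz(1)[OF that]] by simp
  have \<tau>: "\<tau> i > 0" if "i \<in> ?N" for i
    unfolding \<tau>_def using sigma_min_pos[OF nz(1)[OF that]] by simp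
  have sumF: "(\<Sum>i\<in>?N. F i) = T"
    unfolding F_def T_def by (rule sum_frob_norm_rows[OF I]) simp
  have sumg: "(\<Sum>i\<in>?N. g i) = (norm (A *v u))\<^sup>2"
    unfolding g_def by (rule sum_norm_vec_restrict[OF I]) simp
  have sumh: "(\<Sum>i\<in>?N. h i) = (norm e)\<^sup>2"
    unfolding h_def by (rule sum_norm_vec_restrict[OF I]) simp
  have beta: "beta_max_rows A s I = Max ((\<lambda>i. \<sigma> i / F i) ` ?N)"
    by (simp add: beta_max_rows_def \<sigma>_def F_def)
  have beta': "beta_min_rows A s I = Min ((\<lambda>i. \<tau> i / F i) ` ?N)"
    by (simp add: beta_min_rows_def \<tau>_def F_def)
  have "?N \<noteq> {}" using I(2) by auto
  then have betapos: "0 < beta_max_rows A s I"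
    unfolding beta using F \<sigma> by (subst Max_gr_iff) auto
  have "(\<Sum>i\<in>?N. F i / T * (norm (x_step A b (I i) y x - xs))\<^sup>2)
      \<le> (\<Sum>i\<in>?N. F i / T * ((norm u)\<^sup>2 - g i / \<sigma> i + h i / \<tau> i))"
  proof (intro sum_mono mult_left_mono)
    fix i assume i: "i \<in> ?N"
    show "(norm (x_step A b (I i) y x - xs))\<^sup>2 \<le> (norm u)\<^sup>2 - g i / \<sigma> i + h i / \<tau> i"
      using x_step_error[OF b nz(1)[OF i] y, of x] by (simp add: e_def u_def g_def h_def \<sigma>_def \<tau>_def)
  qed (use F T in \<open>auto intro!: divide_nonneg_nonneg intro: less_imp_le\<close>)
  also have "\<dots> = (\<Sum>i\<in>?N. F i / T) * (norm u)\<^sup>2 - (\<Sum>i\<in>?N. F i / T * (g i / \<sigma> i))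
      + (\<Sum>i\<in>?N. F i / T * (h i / \<tau> i))"
    by (simp add: distrib_left right_diff_distrib sum_subtractf sum.distrib sum_distrib_right)
  also have "(\<Sum>i\<in>?N. F i / T) = 1"
    using sumF T by (simp flip: sum_divide_distrib)
  also have "1 * (norm u)\<^sup>2 - (\<Sum>i\<in>?N. F i / T * (g i / \<sigma> i)) + (\<Sum>i\<in>?N. F i / T * (h i / \<tau> i))
      \<le> (norm u)\<^sup>2 - 1 / beta_max_rows A s I * ((sigma_min A UNIV UNIV)\<^sup>2 * (norm u)\<^sup>2 / T)
        + (norm e)\<^sup>2 / (T * beta_min_rows A s I)"
  proof -
    have "sigma_min A UNIV UNIV * norm u \<le> norm (A *v u)"
      using sigma_min_bound[of A UNIV UNIV u] nz(2) x by (simp add: u_def)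
    then have "(sigma_min A UNIV UNIV)\<^sup>2 * (norm u)\<^sup>2 \<le> (\<Sum>i\<in>?N. g i)"
      unfolding sumg using sigma_min_pos[of A UNIV UNIV] nz(2)
      by (metis power_mono power_mult_distrib submatrix_UNIV mult_nonneg_nonneg less_imp_le norm_ge_zero)
    then have "1 / beta_max_rows A s I * ((sigma_min A UNIV UNIV)\<^sup>2 * (norm u)\<^sup>2 / T) \<le> 1 / beta_max_rows A s I * ((\<Sum>i\<in>?N. g i) / T)"
      using betapos T by (intro mult_left_mono divide_right_mono) auto
    also have "\<dots> \<le> (\<Sum>i\<in>?N. F i / T * (g i / \<sigma> i))"
      unfolding beta by (rule weighted_sum_ge_Max) (use F \<sigma> T in \<open>auto simp: g_def\<close>)
    finally have "1 / beta_max_rows A s I * ((sigma_min A UNIV UNIV)\<^sup>2 * (norm u)\<^sup>2 / T) \<le> (\<Sum>i\<in>?N. F i / T * (g i / \<sigma> i))" .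
    moreover have "(\<Sum>i\<in>?N. F i / T * (h i / \<tau> i)) \<le> (norm e)\<^sup>2 / (T * beta_min_rows A s I)"
      unfolding beta' sumh[symmetric] by (rule weighted_sum_le_Min) (use F \<tau> T in \<open>auto simp: h_def\<close>)
    ultimately show ?thesis by linarith
  qed
  finally show ?thesis
    by (simp add: F_def T_def e_def u_def algebra_simps)
qed

section \<open>Expectation conditional on the history\<close>

text \<open>The choices range over all of \<open>nat\<close>; since the probabilities of the block
  indices already add up to one, other values occur only on a null set.\<close>

lemma (in prob_space) AE_in_if_sum_prob_eq_1:
  assumes X: "X \<in> measurable M (count_space UNIV)" and "finite T"
    and sum: "(\<Sum>n\<in>T. prob {w \<in> space M. X w = n}) = 1"
  shows "AE w in M. X w \<in> T"
proof -
  have ev: "{w \<in> space M. X w = n} \<in> events" for n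
    using X by measurable
  have "prob (\<Union>n\<in>T. {w \<in> space M. X w = n}) = (\<Sum>n\<in>T. prob {w \<in> space M. X w = n})"
    using \<open>finite T\<close> ev by (intro finite_measure_finite_Union) (auto simp: disjoint_family_on_def)
  moreover have "(\<Union>n\<in>T. {w \<in> space M. X w = n}) = {w \<in> space M. X w \<in> T}"
    by auto
  moreover have "{w \<in> space M. X w \<in> T} \<in> events"
    using measurable_sets[OF X, of T] by (simp add: vimage_def Int_def conj_commute)
  ultimately show ?thesis
    using sum prob_Collect_eq_1 by simp
qed

context prob_space
begin

context
  fixes X :: "'i \<Rightarrow> 'a \<Rightarrow> nat" and T :: "'i \<Rightarrow> nat set" and K :: "'i set"
  assumes indep: "indep_vars (\<lambda>_. count_space UNIV) X UNIV"
    and T: "\<And>j. finite (T j)" "\<And>j. AE w in M. X j w \<in> T j"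
    and K: "finite K"
begin

text \<open>A finite product of countable discrete spaces is discrete, so every function of the
  history is measurable.\<close>

lemma measurable_history: "(\<lambda>w. H (restrict (\<lambda>j. X j w) K)) \<in> borel_measurable M"
  for H :: "_ \<Rightarrow> real"
proof -
  have "(\<lambda>w. restrict (\<lambda>j. X j w) K) \<in> measurable M (PiM K (\<lambda>_. count_space UNIV))"
    using indep by (intro measurable_restrict) (auto simp: indep_vars_def)
  then have "(\<lambda>w. restrict (\<lambda>j. X j w) K) \<in> measurable M (count_space (PiE K (\<lambda>_. UNIV)))"
    using K by (simp add: count_space_PiM_finite)
  from measurable_compose[OF this, of H borel] show ?thesis by simp
qed

text \<open>Almost surely the history takes one of the finitely many values in
  \<open>PiE K T\<close>, so every function of it is essentially bounded.\<close>

lemma integrable_history: "integrable M (\<lambda>w. H (restrict (\<lambda>j. X j w) K))"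
  for H :: "_ \<Rightarrow> real"
proof (rule integrable_const_bound)
  have "AE w in M. \<forall>j\<in>K. X j w \<in> T j"
    using K T(2) by (simp add: AE_finite_all)
  then show "AE w in M. norm (H (restrict (\<lambda>j. X j w) K)) \<le> (\<Sum>f\<in>PiE K T. norm (H f))"
  proof (rule AE_mp, intro AE_I2 impI)
    fix w assume "\<forall>j\<in>K. X j w \<in> T j"
    then show "norm (H (restrict (\<lambda>j. X j w) K)) \<le> (\<Sum>f\<in>PiE K T. norm (H f))"
      using K T(1) by (intro member_le_sum[of _ "PiE K T" "\<lambda>f. norm (H f)"]) (auto intro: finite_PiE)
  qed
qed (rule measurable_history)

text \<open>Split according to the value \<open>n\<close> of the next choice. Its indicator is
  independent of the history, so each expectation factorises.\<close>

lemma expectation_history_next: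
  fixes G :: "_ \<Rightarrow> nat \<Rightarrow> real"
  assumes i: "i \<notin> K"
  shows "expectation (\<lambda>w. G (restrict (\<lambda>j. X j w) K) (X i w)) =
    (\<Sum>n\<in>T i. prob {w \<in> space M. X i w = n} * expectation (\<lambda>w. G (restrict (\<lambda>j. X j w) K) n))"
proof -
  define Z where "Z w = restrict (\<lambda>j. X j w) K" for w
  have Xi: "X i \<in> measurable M (count_space UNIV)"
    using indep by (simp add: indep_vars_def)
  have meas: "(\<lambda>w. H (Z w)) \<in> borel_measurable M" for H :: "_ \<Rightarrow> real"
    unfolding Z_def by (rule measurable_history)
  have int: "integrable M (\<lambda>w. H (Z w))" for H :: "_ \<Rightarrow> real"
    unfolding Z_def by (rule integrable_history)
  have ind: "indep_var borel (\<lambda>w. G (Z w) n) borel (\<lambda>w. indicator {n} (X i w) :: real)" for n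
  proof -
    have "indep_var (PiM K (\<lambda>_. count_space UNIV)) Z
        (PiM {i} (\<lambda>_. count_space UNIV)) (\<lambda>w. restrict (\<lambda>j. X j w) {i})"
      unfolding Z_def using i by (intro indep_var_restrict[OF indep]) auto
    then have "indep_var borel ((\<lambda>f. G f n) \<circ> Z)
        borel ((\<lambda>f. indicator {n} (f i) :: real) \<circ> (\<lambda>w. restrict (\<lambda>j. X j w) {i}))"
      by (rule indep_var_compose) (simp_all add: K count_space_PiM_finite)
    then show ?thesis by (simp add: o_def)
  qed
  have int_ind: "integrable M (\<lambda>w. indicator {n} (X i w) :: real)" for n
    by (rule integrable_const_bound[where B = 1]) (use Xi in \<open>auto simp: indicator_def\<close>)
  have exp_ind: "expectation (\<lambda>w. indicator {n} (X i w) :: real) = prob {w \<in> space M. X i w = n}" for n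
  proof -
    have "expectation (\<lambda>w. indicator {n} (X i w) :: real) = expectation (indicator {w \<in> space M. X i w = n})"
      by (intro Bochner_Integration.integral_cong) (auto simp: indicator_def)
    also have "\<dots> = prob ({w \<in> space M. X i w = n} \<inter> space M)"
      by simp
    also have "{w \<in> space M. X i w = n} \<inter> space M = {w \<in> space M. X i w = n}"
      by blast
    finally show ?thesis .
  qed
  have "expectation (\<lambda>w. G (Z w) (X i w)) = expectation (\<lambda>w. \<Sum>n\<in>T i. G (Z w) n * indicator {n} (X i w))"
  proof (rule integral_cong_AE)
    show "(\<lambda>w. G (Z w) (X i w)) \<in> borel_measurable M"
      by (rule measurable_compose_countable[OF meas Xi])
    show "(\<lambda>w. \<Sum>n\<in>T i. G (Z w) n * indicator {n} (X i w)) \<in> borel_measurable M"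
      using meas int_ind by (intro borel_measurable_sum borel_measurable_times) auto
    show "AE w in M. G (Z w) (X i w) = (\<Sum>n\<in>T i. G (Z w) n * indicator {n} (X i w))"
      using T(2)[of i]
    proof (rule AE_mp, intro AE_I2 impI)
      fix w assume "X i w \<in> T i"
      then show "G (Z w) (X i w) = (\<Sum>n\<in>T i. G (Z w) n * indicator {n} (X i w))"
        using T(1)[of i] by (simp add: indicator_def if_distrib[of "\<lambda>x. _ * x"] cong: if_cong)
    qed
  qed
  also have "\<dots> = (\<Sum>n\<in>T i. expectation (\<lambda>w. G (Z w) n * indicator {n} (X i w)))"
    by (intro Bochner_Integration.integral_sum indep_var_integrable[OF ind] int int_ind)
  also have "\<dots> = (\<Sum>n\<in>T i. expectation (\<lambda>w. G (Z w) n) * prob {w \<in> space M. X i w = n})"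
    by (simp add: indep_var_lebesgue_integral[OF ind int int_ind] exp_ind)
  finally show ?thesis
    by (simp add: Z_def mult.commute)
qed

text \<open>The tower property in elementary form: it suffices to bound the average over the next
  choice for each fixed history \<open>f\<close>.\<close>

lemma expectation_history_next_le:
  fixes G :: "_ \<Rightarrow> nat \<Rightarrow> real"
  assumes i: "i \<notin> K"
    and le: "\<And>f. (\<Sum>n\<in>T i. prob {w \<in> space M. X i w = n} * G f n) \<le> H f"
  shows "expectation (\<lambda>w. G (restrict (\<lambda>j. X j w) K) (X i w)) \<le> expectation (\<lambda>w. H (restrict (\<lambda>j. X j w) K))"
proof -
  have "expectation (\<lambda>w. G (restrict (\<lambda>j. X j w) K) (X i w)) =
      expectation (\<lambda>w. \<Sum>n\<in>T i. prob {w \<in> space M. X i w = n} * G (restrict (\<lambda>j. X j w) K) n)"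
    unfolding expectation_history_next[OF i]
    by (subst Bochner_Integration.integral_sum) (simp_all add: integrable_history[of "\<lambda>f. G f _"])
  also have "\<dots> \<le> expectation (\<lambda>w. H (restrict (\<lambda>j. X j w) K))"
    by (intro integral_mono le) (rule integrable_history)+
  finally show ?thesis .
qed

end

end

text \<open>Iterate \<open>k\<close> depends only on the choices of the first \<open>k\<close>
  steps, which makes it a function of the history.\<close>

lemma ermr_cong:
  assumes "\<And>l. l < k \<Longrightarrow> ri l = ri' l" "\<And>l. l < k \<Longrightarrow> cj l = cj' l"
  shows "ermr A b I J x0 y0 ri cj k = ermr A b I J x0 y0 ri' cj' k"
  using assms by (induction k) (simp_all add: Let_def)

section \<open>Two coupled linear recurrences\<close>

text \<open>Unrolling gives a sum of products of powers of \<open>r\<close> and \<open>q\<close>,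
  which is the divided difference \<open>(r ^ k - q ^ k) / (r - q)\<close>. The extra factor
  \<open>q\<close> arises because \<open>a (Suc k)\<close> depends on the updated
  \<open>e (Suc k)\<close>.\<close>

lemma coupled_geometric_bound:
  fixes a e :: "nat \<Rightarrow> real"
  assumes a: "\<And>k. a (Suc k) \<le> r * a k + C * e (Suc k)"
    and e: "\<And>k. e (Suc k) \<le> q * e k"
    and nonneg: "0 \<le> r" "0 \<le> q" "0 \<le> C" and "r \<noteq> q"
  shows "a k \<le> r ^ k * a 0 + C * e 0 * q * ((r ^ k - q ^ k) / (r - q))"
proof (induction k)
  case (Suc k)
  have e_le: "e k \<le> q ^ k * e 0" for k
  proof (induction k)
    case (Suc k)
    have "e (Suc k) \<le> q * (q ^ k * e 0)"
      using e[of k] mult_left_mono[OF Suc nonneg(2)] by simp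
    then show ?case by simp
  qed simp
  have "a (Suc k) \<le> r * (r ^ k * a 0 + C * e 0 * q * ((r ^ k - q ^ k) / (r - q))) + C * (q ^ Suc k * e 0)"
    using a[of k] mult_left_mono[OF Suc nonneg(1)] mult_left_mono[OF e_le[of "Suc k"] nonneg(3)] by simp
  also have "\<dots> = r ^ Suc k * a 0 + C * e 0 * q * ((r ^ Suc k - q ^ Suc k) / (r - q))"
    using \<open>r \<noteq> q\<close> by (simp add: field_simps)
  finally show ?case .
qed simp

text \<open>Both powers lie between zero and \<open>(max r q) ^ k\<close>, hence so does the
  absolute value of their difference; \<open>q \<le> 1\<close> absorbs the extra factor.\<close>

lemma coupled_geometric_bound_max:
  fixes a e :: "nat \<Rightarrow> real"
  assumes a: "\<And>k. a (Suc k) \<le> r * a k + C * e (Suc k)"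
    and e: "\<And>k. e (Suc k) \<le> q * e k"
    and nonneg: "0 \<le> r" "0 \<le> q" "q \<le> 1" "0 \<le> C" "0 \<le> a 0" "0 \<le> e 0" and "r \<noteq> q"
  shows "a k \<le> (a 0 + C * e 0 / \<bar>r - q\<bar>) * (max r q) ^ k"
proof -
  have pow: "r ^ k \<le> (max r q) ^ k" "q ^ k \<le> (max r q) ^ k" "0 \<le> r ^ k" "0 \<le> q ^ k"
    using nonneg by (auto intro: power_mono)
  have "(r ^ k - q ^ k) / (r - q) \<le> \<bar>(r ^ k - q ^ k) / (r - q)\<bar>" by (rule abs_ge_self)
  also have "\<dots> \<le> (max r q) ^ k / \<bar>r - q\<bar>"
    unfolding abs_divide using pow by (intro divide_right_mono) auto
  finally have "(r ^ k - q ^ k) / (r - q) \<le> (max r q) ^ k / \<bar>r - q\<bar>" .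
  then have "C * e 0 * q * ((r ^ k - q ^ k) / (r - q)) \<le> C * e 0 * q * ((max r q) ^ k / \<bar>r - q\<bar>)"
    using nonneg by (intro mult_left_mono) auto
  also have "\<dots> \<le> C * e 0 * 1 * ((max r q) ^ k / \<bar>r - q\<bar>)"
    using nonneg by (intro mult_right_mono mult_left_mono) auto
  finally have "r ^ k * a 0 + C * e 0 * q * ((r ^ k - q ^ k) / (r - q))
      \<le> (max r q) ^ k * a 0 + C * e 0 * ((max r q) ^ k / \<bar>r - q\<bar>)"
    using mult_right_mono[OF pow(1) nonneg(5)] by simp
  also have "\<dots> = (a 0 + C * e 0 / \<bar>r - q\<bar>) * (max r q) ^ k"
    by (simp add: algebra_simps)
  finally show ?thesis
    using coupled_geometric_bound[of a r C e q k, OF a e nonneg(1,2,4) \<open>r \<noteq> q\<close>] by linarith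
qed

section \<open>The convergence theorem\<close>

lemma beta_max_cols_pos:
  fixes A :: "real^'n^'m"
  assumes "(\<Union>j\<in>{1..t}. J j) = UNIV" "\<And>j. j \<in> {1..t} \<Longrightarrow> submatrix A UNIV (J j) \<noteq> 0"
  shows "0 < beta_max_cols A t J"
proof -
  have "0 < (sigma_max A UNIV (J j))\<^sup>2 / (frob_norm A UNIV (J j))\<^sup>2" if "j \<in> {1..t}" for j
    using frob_norm_pos[OF assms(2)[OF that]] sigma_max_pos[OF assms(2)[OF that]] by simp
  moreover have "{1..t} \<noteq> {}" using assms(1) by auto
  ultimately show ?thesis
    unfolding beta_max_cols_def by (subst Max_gr_iff) blast+
qed

lemma beta_min_rows_pos:
  fixes A :: "real^'n^'m"
  assumes "(\<Union>i\<in>{1..s}. I i) = UNIV" "\<And>i. i \<in> {1..s} \<Longrightarrow> submatrix A (I i) UNIV \<noteq> 0"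
  shows "0 < beta_min_rows A s I"
proof -
  have "0 < (sigma_min A (I i) UNIV)\<^sup>2 / (frob_norm A (I i) UNIV)\<^sup>2" if "i \<in> {1..s}" for i
    using frob_norm_pos[OF assms(2)[OF that]] sigma_min_pos[OF assms(2)[OF that]] by simp
  moreover have "{1..s} \<noteq> {}" using assms(1) by auto
  ultimately show ?thesis
    unfolding beta_min_rows_def by (subst Min_gr_iff) auto
qed

text \<open>Every correction lies in the respective range, so the errors never leave the subspaces
  on which \<open>sigma_min\<close> gives a lower bound.\<close>

lemma ermr_in_range:
  fixes A :: "real^'n^'m" and xs :: "real^'n"
  assumes "x0 - xs \<in> range (\<lambda>v. transpose A *v v)" "y0 - bN \<in> range (\<lambda>v. A *v v)"
  shows "fst (ermr A b I J x0 y0 ri cj k) - xs \<in> range (\<lambda>v. transpose A *v v)"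
    and "snd (ermr A b I J x0 y0 ri cj k) - bN \<in> range (\<lambda>v. A *v v)"
proof (induction k)
  case (Suc k)
  have *: "w - u = (w - v) + (v - u)" for u v w :: "real^'n" by simp
  have **: "w - u = (w - v) + (v - u)" for u v w :: "real^'m" by simp
  case 1
  show ?case
    using Suc(1)
    by (subst *[of _ _ "fst (ermr A b I J x0 y0 ri cj k)"])
      (auto simp only: ermr.simps Let_def fst_conv intro!: subspace_add[OF subspace_range_matrix] x_step_diff_in_range)
  case 2
  show ?case
    using Suc(2)
    by (subst **[of _ _ "snd (ermr A b I J x0 y0 ri cj k)"])
      (auto simp only: ermr.simps Let_def snd_conv intro!: subspace_add[OF subspace_range_matrix] y_step_diff_in_range)
qed (use assms in simp_all)

theorem theorem3p1:
  fixes A :: "real^'n^'m" and b :: "real^'m"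
    and s t :: nat and I :: "nat \<Rightarrow> 'm set" and J :: "nat \<Rightarrow> 'n set"
    and x0 :: "real^'n" and y0 :: "real^'m"
    and M :: "'w measure" and row_choice col_choice :: "nat \<Rightarrow> 'w \<Rightarrow> nat"
    and x :: "nat \<Rightarrow> 'w \<Rightarrow> real^'n" and x_star :: "real^'n" and b_N :: "real^'m"
    and \<rho>1 \<rho>2 \<rho> \<omega> :: real
  assumes "CARD('m) > CARD('n)"
    and "A \<noteq> 0"
    and inconsistent: "\<nexists>z. A *v z = b"
    and row_partition: "disjoint_family_on I {1..s}" "(\<Union>i\<in>{1..s}. I i) = UNIV"
    and col_partition: "disjoint_family_on J {1..t}" "(\<Union>j\<in>{1..t}. J j) = UNIV"
    and row_blocks_nonzero: "\<And>i. i \<in> {1..s} \<Longrightarrow> \<exists>l\<in>I i. row l A \<noteq> 0"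
    and col_blocks_nonzero: "\<And>j. j \<in> {1..t} \<Longrightarrow> \<exists>l\<in>J j. column l A \<noteq> 0"
    and x0: "x0 \<in> range (\<lambda>v. transpose A *v v)"
    and y0: "y0 \<in> (\<lambda>v. b + v) ` range (\<lambda>z. A *v z)"
    and "prob_space M"
    and indep: "prob_space.indep_vars M (\<lambda>_. count_space UNIV)
                  (case_sum row_choice col_choice) (UNIV :: (nat + nat) set)"
    and row_prob: "\<And>k i. i \<in> {1..s} \<Longrightarrow>
           measure M {w \<in> space M. row_choice k w = i}
             = (frob_norm A (I i) UNIV)\<^sup>2 / (frob_norm A UNIV UNIV)\<^sup>2"
    and col_prob: "\<And>k j. j \<in> {1..t} \<Longrightarrow>
           measure M {w \<in> space M. col_choice k w = j}
             = (frob_norm A UNIV (J j))\<^sup>2 / (frob_norm A UNIV UNIV)\<^sup>2"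
    and x: "\<And>k w. x k w = fst (ermr A b I J x0 y0 (\<lambda>k. row_choice k w) (\<lambda>k. col_choice k w) k)"
    and \<rho>1: "\<rho>1 = 1 - 1 / beta_max_rows A s I *
                   ((sigma_min A UNIV UNIV)\<^sup>2 / (frob_norm A UNIV UNIV)\<^sup>2)"
    and \<rho>2: "\<rho>2 = 1 - 1 / beta_max_cols A t J *
                   ((sigma_min A UNIV UNIV)\<^sup>2 / (frob_norm A UNIV UNIV)\<^sup>2)"
    and "\<rho>1 \<noteq> \<rho>2"
    and x_star: "x_star = pinv A *v b"
    and b_N: "b_N = (mat 1 - A ** pinv A) *v b"
    and \<rho>: "\<rho> = max \<rho>1 \<rho>2"
    and \<omega>: "\<omega> = (norm (x0 - x_star))\<^sup>2 +
               real s / \<bar>\<rho>1 - \<rho>2\<bar> *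
               ((norm (y0 - b_N))\<^sup>2 / ((frob_norm A UNIV UNIV)\<^sup>2 * beta_min_rows A s I))"
  shows "\<forall>k. prob_space.expectation M (\<lambda>w. (norm (x k w - x_star))\<^sup>2) \<le> \<omega> * \<rho> ^ k"
proof -
  interpret prob_space M by fact
  define X where "X = case_sum row_choice col_choice"
  define T where "T = case_sum (\<lambda>_::nat. {1..s}) (\<lambda>_::nat. {1..t})"
  define F where "F = (frob_norm A UNIV UNIV)\<^sup>2"
  define C where "C = 1 / (F * beta_min_rows A s I)"
  \<comment> \<open>All choices form one family on \<open>nat + nat\<close>, with \<open>Inl\<close>
    for rows and \<open>Inr\<close> for columns; \<open>K k\<close> collects those made before step
    \<open>k\<close>.\<close>
  define st where "st k f = ermr A b I J x0 y0 (\<lambda>k. f (Inl k)) (\<lambda>k. f (Inr k)) k" for k f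
  define K :: "nat \<Rightarrow> (nat + nat) set" where "K k = Inl ` {..<k} \<union> Inr ` {..<k}" for k
  define a where "a k = expectation (\<lambda>w. (norm (fst (st k (\<lambda>j. X j w)) - x_star))\<^sup>2)" for k
  define e where "e k = expectation (\<lambda>w. (norm (snd (st k (\<lambda>j. X j w)) - b_N))\<^sup>2)" for k

  have rows: "submatrix A (I i) UNIV \<noteq> 0" if "i \<in> {1..s}" for i
    using row_blocks_nonzero[OF that] by (auto simp: submatrix_def row_def vec_eq_iff)
  have cols: "submatrix A UNIV (J j) \<noteq> 0" if "j \<in> {1..t}" for j
    using col_blocks_nonzero[OF that] by (auto simp: submatrix_def column_def vec_eq_iff)
  have F: "0 < F"
    unfolding F_def using \<open>A \<noteq> 0\<close> by (intro frob_norm_pos) simp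
  have C: "0 \<le> C"
    unfolding C_def using F beta_min_rows_pos[OF row_partition(2) rows] by simp
  have b: "b = b_N + A *v x_star"
    by (simp add: b_N x_star matrix_vector_mult_diff_rdistrib matrix_vector_mul_assoc)
  have bN: "transpose A *v b_N = 0"
    using transpose_pinv_residual[of A b]
    by (simp add: b_N matrix_vector_mult_diff_rdistrib matrix_vector_mul_assoc)
  have x0': "x0 - x_star \<in> range (\<lambda>v. transpose A *v v)"
    using x0 pinv_mult_in_range[of A b] unfolding x_star by (intro subspace_diff subspace_range_matrix)
  have y0': "y0 - b_N \<in> range (\<lambda>v. A *v v)"
  proof -
    obtain z where "y0 = b + A *v z" using y0 by blast
    then have "y0 - b_N = A *v (z + x_star)"
      by (subst (asm) b) (simp add: matrix_vector_right_distrib)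
    then show ?thesis by blast
  qed
  have range: "fst (st k f) - x_star \<in> range (\<lambda>v. transpose A *v v)"
    "snd (st k f) - b_N \<in> range (\<lambda>v. A *v v)" for k f
    unfolding st_def by (rule ermr_in_range[OF x0' y0'])+

  \<comment> \<open>Distribution of the block choices\<close>
  have indepX: "indep_vars (\<lambda>_. count_space UNIV) X UNIV"
    unfolding X_def by (rule indep)
  have finT: "finite (T j)" for j
    by (cases j) (simp_all add: T_def)
  have rowP: "prob {w \<in> space M. X (Inl k) w = i} = (frob_norm A (I i) UNIV)\<^sup>2 / F" if "i \<in> {1..s}" for k i
    using row_prob[OF that] by (simp add: X_def F_def)
  have colP: "prob {w \<in> space M. X (Inr k) w = j} = (frob_norm A UNIV (J j))\<^sup>2 / F" if "j \<in> {1..t}" for k j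
    using col_prob[OF that] by (simp add: X_def F_def)
  have AET: "AE w in M. X j w \<in> T j" for j
  proof (rule AE_in_if_sum_prob_eq_1)
    show "X j \<in> measurable M (count_space UNIV)"
      using indepX by (simp add: indep_vars_def)
    show "(\<Sum>n\<in>T j. prob {w \<in> space M. X j w = n}) = 1"
    proof (cases j)
      case (Inl k)
      have "(\<Sum>n\<in>T j. prob {w \<in> space M. X j w = n}) = (\<Sum>i\<in>{1..s}. (frob_norm A (I i) UNIV)\<^sup>2) / F"
        unfolding sum_divide_distrib by (intro sum.cong) (simp_all add: Inl T_def rowP)
      also have "\<dots> = 1"
        using F sum_frob_norm_rows[OF row_partition, of A UNIV] by (simp add: F_def)
      finally show ?thesis .
    next
      case (Inr k)
      have "(\<Sum>n\<in>T j. prob {w \<in> space M. X j w = n}) = (\<Sum>i\<in>{1..t}. (frob_norm A UNIV (J i))\<^sup>2) / F"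
        unfolding sum_divide_distrib by (intro sum.cong) (simp_all add: Inr T_def colP)
      also have "\<dots> = 1"
        using F sum_frob_norm_cols[OF col_partition, of A UNIV] by (simp add: F_def)
      finally show ?thesis .
    qed
  qed (rule finT)
  note history = indepX finT AET

  have y_mean: "(\<Sum>j\<in>{1..t}. (frob_norm A UNIV (J j))\<^sup>2 / F * (norm (y_step A (J j) y - b_N))\<^sup>2) \<le> \<rho>2 * (norm (y - b_N))\<^sup>2"
    if "y - b_N \<in> range (\<lambda>v. A *v v)" for y
    unfolding F_def \<rho>2 by (rule y_step_mean_error[OF col_partition cols \<open>A \<noteq> 0\<close> bN that])
  have x_mean: "(\<Sum>i\<in>{1..s}. (frob_norm A (I i) UNIV)\<^sup>2 / F * (norm (x_step A b (I i) y x - x_star))\<^sup>2)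
      \<le> \<rho>1 * (norm (x - x_star))\<^sup>2 + C * (norm (y - b_N))\<^sup>2"
    if "y - b_N \<in> range (\<lambda>v. A *v v)" "x - x_star \<in> range (\<lambda>v. transpose A *v v)" for x y
    using x_step_mean_error[OF row_partition rows \<open>A \<noteq> 0\<close> b that]
    unfolding F_def \<rho>1 C_def by simp

  have fin_K: "finite (K k)" "finite (insert (Inr k) (K k))" for k
    by (simp_all add: K_def)
  have st_restrict: "st k (restrict f L) = st k f" if "K k \<subseteq> L" for k f L
    unfolding st_def using that by (intro ermr_cong) (auto simp: K_def)
  have snd_st_Suc: "snd (st (Suc k) f) = y_step A (J (f (Inr k))) (snd (st k f))" for k f
    by (simp add: st_def Let_def)
  have fst_st_Suc: "fst (st (Suc k) f) = x_step A b (I (f (Inl k))) (snd (st (Suc k) f)) (fst (st k f))" for k f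
    by (simp add: st_def Let_def)

  \<comment> \<open>Recurrences for the mean squared errors\<close>
  have e_step: "e (Suc k) \<le> \<rho>2 * e k" for k
  proof -
    define G where "G f n = (norm (y_step A (J n) (snd (st k f)) - b_N))\<^sup>2" for f n
    have "e (Suc k) = expectation (\<lambda>w. G (restrict (\<lambda>j. X j w) (K k)) (X (Inr k) w))"
      unfolding e_def G_def by (simp add: snd_st_Suc st_restrict)
    also have "\<dots> \<le> expectation (\<lambda>w. \<rho>2 * (norm (snd (st k (restrict (\<lambda>j. X j w) (K k))) - b_N))\<^sup>2)"
    proof (rule expectation_history_next_le[OF history fin_K(1), where H = "\<lambda>f. \<rho>2 * (norm (snd (st k f) - b_N))\<^sup>2"])
      show "Inr k \<notin> K k" by (auto simp: K_def)
      show "(\<Sum>n\<in>T (Inr k). prob {w \<in> space M. X (Inr k) w = n} * G f n) \<le> \<rho>2 * (norm (snd (st k f) - b_N))\<^sup>2" for f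
        using y_mean[OF range(2)[of k f]] by (simp add: T_def G_def colP)
    qed
    also have "\<dots> = \<rho>2 * e k"
      by (simp add: e_def st_restrict)
    finally show ?thesis .
  qed

  have a_step: "a (Suc k) \<le> \<rho>1 * a k + C * e (Suc k)" for k
  proof -
    \<comment> \<open>The row choice of step \<open>k\<close> comes after its column choice, so the
      history it is averaged against contains \<open>Inr k\<close>.\<close>
    let ?K = "insert (Inr k) (K k)"
    define y' where "y' f = y_step A (J (f (Inr k))) (snd (st k f))" for f
    define G where "G f n = (norm (x_step A b (I n) (y' f) (fst (st k f)) - x_star))\<^sup>2" for f n
    have y'_restrict: "y' (restrict f ?K) = y' f" for f
      by (simp add: y'_def st_restrict subset_insertI)
    have y': "y' f = snd (st (Suc k) f)" for f
      by (simp add: y'_def snd_st_Suc)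
    have "a (Suc k) = expectation (\<lambda>w. G (restrict (\<lambda>j. X j w) ?K) (X (Inl k) w))"
      unfolding a_def G_def y'_restrict by (simp add: fst_st_Suc st_restrict subset_insertI y')
    also have "\<dots> \<le> expectation (\<lambda>w. \<rho>1 * (norm (fst (st k (restrict (\<lambda>j. X j w) ?K)) - x_star))\<^sup>2
        + C * (norm (y' (restrict (\<lambda>j. X j w) ?K) - b_N))\<^sup>2)"
    proof (rule expectation_history_next_le[OF history fin_K(2),
          where H = "\<lambda>f. \<rho>1 * (norm (fst (st k f) - x_star))\<^sup>2 + C * (norm (y' f - b_N))\<^sup>2"])
      show "Inl k \<notin> ?K" by (auto simp: K_def)
      show "(\<Sum>n\<in>T (Inl k). prob {w \<in> space M. X (Inl k) w = n} * G f n)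
          \<le> \<rho>1 * (norm (fst (st k f) - x_star))\<^sup>2 + C * (norm (y' f - b_N))\<^sup>2" for f
        using x_mean[OF range(2)[of "Suc k" f] range(1)[of k f]] by (simp add: T_def G_def rowP y')
    qed
    also have "\<dots> = \<rho>1 * expectation (\<lambda>w. (norm (fst (st k (restrict (\<lambda>j. X j w) ?K)) - x_star))\<^sup>2)
        + C * expectation (\<lambda>w. (norm (y' (restrict (\<lambda>j. X j w) ?K) - b_N))\<^sup>2)"
      using integrable_history[OF history fin_K(2), of "\<lambda>f. (norm (fst (st k f) - x_star))\<^sup>2" k]
        integrable_history[OF history fin_K(2), of "\<lambda>f. (norm (y' f - b_N))\<^sup>2" k]
      by (subst Bochner_Integration.integral_add) simp_all
    also have "\<dots> = \<rho>1 * a k + C * e (Suc k)"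
      unfolding y'_restrict by (simp add: a_def e_def st_restrict subset_insertI y')
    finally show ?thesis .
  qed

  \<comment> \<open>\<open>A *v v\<close> and \<open>transpose A *v r\<close> serve as nonzero test
    errors in the two subspaces. For \<open>\<rho>1\<close> the choice \<open>y = b_N\<close>
    removes the term with \<open>C\<close>.\<close>
  obtain v where v: "A *v v \<noteq> 0"
    using \<open>A \<noteq> 0\<close> by (metis matrix_eq matrix_vector_mult_0)
  then obtain r where r: "transpose A *v r \<noteq> 0"
    using gram_eq_0_iff by blast
  txt \<open>Both contraction factors are nonnegative because they bound a mean squared error by a multiple
    of a positive number.\<close>
  have \<rho>1_nonneg: "0 \<le> \<rho>1"
  proof -
    have "0 \<le> (\<Sum>i\<in>{1..s}. (frob_norm A (I i) UNIV)\<^sup>2 / F * (norm (x_step A b (I i) b_N (x_star + transpose A *v r) - x_star))\<^sup>2)"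
      using F by (intro sum_nonneg) simp
    also have "\<dots> \<le> \<rho>1 * (norm (transpose A *v r))\<^sup>2"
      using x_mean[of b_N "x_star + transpose A *v r"] subspace_0[OF subspace_range_matrix[of A]] by simp
    finally show ?thesis
      using r by (simp add: zero_le_mult_iff)
  qed
  have \<rho>2_nonneg: "0 \<le> \<rho>2"
  proof -
    have "0 \<le> (\<Sum>j\<in>{1..t}. (frob_norm A UNIV (J j))\<^sup>2 / F * (norm (y_step A (J j) (b_N + A *v v) - b_N))\<^sup>2)"
      using F by (intro sum_nonneg) simp
    also have "\<dots> \<le> \<rho>2 * (norm (A *v v))\<^sup>2"
      using y_mean[of "b_N + A *v v"] by simp
    finally show ?thesis
      using v by (simp add: zero_le_mult_iff)
  qed

  \<comment> \<open>Solving the recurrences\<close>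
  have "\<rho>2 \<le> 1"
    using beta_max_cols_pos[OF col_partition(2) cols] unfolding \<rho>2 by simp
  have a0: "a 0 = (norm (x0 - x_star))\<^sup>2" and e0: "e 0 = (norm (y0 - b_N))\<^sup>2"
    by (simp_all add: a_def e_def st_def prob_space)
  have bound: "a k \<le> (a 0 + C * e 0 / \<bar>\<rho>1 - \<rho>2\<bar>) * \<rho> ^ k" for k
    unfolding \<rho>
    by (rule coupled_geometric_bound_max[of a \<rho>1 C e \<rho>2, OF a_step e_step \<rho>1_nonneg \<rho>2_nonneg \<open>\<rho>2 \<le> 1\<close> C _ _ \<open>\<rho>1 \<noteq> \<rho>2\<close>])
      (simp_all add: a0 e0)
  \<comment> \<open>The blocks cover a nonempty index set, so at least one exists, and multiplying
    the second term by \<open>s\<close> can only enlarge the bound.\<close>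
  have "1 \<le> s"
    using row_partition(2) by (cases s) auto
  then have "C * e 0 / \<bar>\<rho>1 - \<rho>2\<bar> * 1 \<le> C * e 0 / \<bar>\<rho>1 - \<rho>2\<bar> * real s"
    using C e0 by (intro mult_left_mono) simp_all
  then have "a 0 + C * e 0 / \<bar>\<rho>1 - \<rho>2\<bar> \<le> \<omega>"
    by (simp add: \<omega> a0 e0 C_def F_def mult_ac)
  then have "a k \<le> \<omega> * \<rho> ^ k" for k
    using bound[of k] \<rho>1_nonneg \<rho> by (meson max.coboundedI1 mult_right_mono order_trans zero_le_power)
  then show ?thesis
    by (simp add: a_def x st_def X_def)
qed

end
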